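(* Let $n\in\mathbb N$ and let $u\in W^n_{2,\rho}(\mathbb R^d;\widetilde\Omega^\ast)$. Let $u_+,u_-\in L^2(\mathbb R^d)$ be the spectral components of $u$ defined by $$\widehat u_+(\xi)=\chi_{\Omega^\ast}(\xi)\widehat u(\xi),\qquad \widehat u_-(\xi)=\chi_{-\Omega^\ast}(\xi)\widehat u(\xi).$$ Then there exist unique functions $F_+\in H^n_{2,\rho}(T_\Omega)$ and $F_-\in H^n_{2,\rho}(T_{-\Omega})$ such that (i) $F_+$ and $F_-$ admit $L^2$ boundary values $u_+$ and $u_-$, respectively; (ii) the boundary decomposition $u=u_++u_-$ holds in $L^2(\mathbb R^d)$; (iii) the norm identity $$\|u\|^2_{W^n_{2,\rho}(\mathbb R^d;\widetilde\Omega^\ast)}=\|F_+\|^2_{H^n_{2,\rho}(T_\Omega)}+\|F_-\|^2_{H^n_{2,\rho}(T_{-\Omega})}$$ is satisfied.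
   Context: Let $d\ge 1$ and let $\Omega\subset\mathbb R^d$ be a nonempty open convex cone containing no complete straight line. Its dual cone is $\Omega^\ast=\{\xi\in\mathbb R^d:\langle x,\xi\rangle\ge 0\text{ for all }x\in\Omega\}$. Put $T_\Omega=\mathbb R^d+i\Omega$ and $T_{-\Omega}=\mathbb R^d-i\Omega$, domains in $\mathbb C^d$. For $z\in\mathbb C^d$, $\xi\in\mathbb R^d$, $\langle z,\xi\rangle=\sum_{j=1}^d z_j\xi_j$ (bilinear). $\chi_E$ is the indicator function of $E$. Fix a continuous function $\rho:\Omega^\ast\to[0,\infty)$ with $\rho(\xi)>0$ for $\xi\ne 0$ and $\rho(t\xi)=t\rho(\xi)$ for all $t>0$, $\xi\in\Omega^\ast$ (so $\rho(0)=0$). For $n\in\mathbb N$ let $w_n(\xi)=\sum_{k=0}^n\rho(\xi)^{2k}$ on $\Omega^\ast$. $H^n_{2,\rho}(T_\Omega)$ is the space of holomorphic $F$ on $T_\Omega$ of the form $F(z)=\int_{\Omega^\ast}e^{i\langle z,\xi\rangle}f(\xi)\,d\xi$ with $\|f\|_{L^2(\Omega^\ast,w_n)}^2=\int_{\Omega^\ast}|f|^2w_n\,d\xi<\infty$; its norm is the infimum of $\|f\|_{L^2(\Omega^\ast,w_n)}$ over all such representing $f$. Analogously, $H^n_{2,\rho}(T_{-\Omega})$ is the space of holomorphic $F$ on $T_{-\Omega}$ of the form $F(z)=\int_{-\Omega^\ast}e^{i\langle z,\eta\rangle}g(\eta)\,d\eta$ with $\int_{-\Omega^\ast}|g(\eta)|^2w_n(-\eta)\,d\eta<\infty$;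 its norm is the infimum of $\left(\int_{-\Omega^\ast}|g(\eta)|^2w_n(-\eta)\,d\eta\right)^{1/2}$ over all such $g$. The Fourier transform is $\widehat u(\xi)=(2\pi)^{-d}\int_{\mathbb R^d}u(x)e^{-i\langle x,\xi\rangle}\,dx$ for $u\in L^1(\mathbb R^d)$, extended as usual to $L^2(\mathbb R^d)$; thus the inversion formula is $u(x)=\int_{\mathbb R^d}\widehat u(\xi)e^{i\langle x,\xi\rangle}\,d\xi$. Let $\widetilde\Omega^\ast=\Omega^\ast\cup(-\Omega^\ast)$ (the two cones meet only at $0$), and let $\widetilde w_n(\xi)=w_n(\xi)$ for $\xi\in\Omega^\ast$ and $\widetilde w_n(\xi)=w_n(-\xi)$ for $\xi\in-\Omega^\ast$. $W^n_{2,\rho}(\mathbb R^d;\widetilde\Omega^\ast)$ is the space of $u\in L^2(\mathbb R^d)$ with $\operatorname{ess\,supp}\widehat u\subset\widetilde\Omega^\ast$ and $\|u\|^2_{W^n_{2,\rho}(\mathbb R^d;\widetilde\Omega^\ast)}:=\int_{\widetilde\Omega^\ast}|\widehat u(\xi)|^2\widetilde w_n(\xi)\,d\xi<\infty$. "$F_+$ admits the $L^2$ boundary value $u_+$" means $F_+(\cdot+iy)\to u_+$ in $L^2(\mathbb R^d)$ as $y\to0$ within $\Omega$; "$F_-$ admits the $L^2$ boundary value $u_-$" means $F_-(\cdot-iy)\to u_-$ in $L^2(\mathbb R^d)$ as $y\to0$ within $\Omega$. *)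

theory Defs
  imports "HOL-Analysis.Analysis" "HOL-Library.FuncSet"
begin

text \<open>
  Elements of \<open>L\<^sup>2\<close> are represented by Borel functions; identities between them are stated
  almost everywhere.
\<close>

definition L2 :: "(real ^ 'd \<Rightarrow> complex) set" where
  "L2 = {u. u \<in> borel_measurable lborel \<and> integrable lborel (\<lambda>x. (cmod (u x))\<^sup>2)}"

definition L2_norm :: "(real ^ 'd \<Rightarrow> complex) \<Rightarrow> real" where
  "L2_norm u = sqrt (\<integral>x. (cmod (u x))\<^sup>2 \<partial>lborel)"

text \<open>
  The membership conditions are needed because the Bochner integral in \<^const>\<open>L2_norm\<close>
  is 0 for functions that are not square integrable.
\<close>

definition L2_tendsto ::
    "('i \<Rightarrow> real ^ 'd \<Rightarrow> complex) \<Rightarrow> (real ^ 'd \<Rightarrow> complex) \<Rightarrow> 'i filter \<Rightarrow> bool" where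
  "L2_tendsto f u A \<longleftrightarrow>
     u \<in> L2 \<and> (\<forall>\<^sub>F i in A. f i \<in> L2) \<and> ((\<lambda>i. L2_norm (\<lambda>x. f i x - u x)) \<longlongrightarrow> 0) A"

definition fourier :: "(real ^ 'd \<Rightarrow> complex) \<Rightarrow> real ^ 'd \<Rightarrow> complex" where
  "fourier u \<xi> =
     (1 / (2 * pi) ^ CARD('d)) *\<^sub>R (\<integral>x. u x * exp (- \<i> * complex_of_real (x \<bullet> \<xi>)) \<partial>lborel)"

text \<open>
  Continuous extension of \<^const>\<open>fourier\<close> from \<open>L\<^sup>1 \<inter> L\<^sup>2\<close> to \<open>L\<^sup>2\<close>. By Plancherel a limit exists,
  and it is independent of the approximating sequence up to null sets.
\<close>

definition is_fourier_L2 :: "(real ^ 'd \<Rightarrow> complex) \<Rightarrow> (real ^ 'd \<Rightarrow> complex) \<Rightarrow> bool" where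
  "is_fourier_L2 u g \<longleftrightarrow>
     (\<exists>v. (\<forall>k. integrable lborel (v k) \<and> v k \<in> L2) \<and>
          L2_tendsto v u sequentially \<and>
          L2_tendsto (\<lambda>k. fourier (v k)) g sequentially)"

definition fourier_L2 :: "(real ^ 'd \<Rightarrow> complex) \<Rightarrow> real ^ 'd \<Rightarrow> complex" where
  "fourier_L2 u = (SOME g. is_fourier_L2 u g)"

text \<open>The complement of the largest open set on which \<open>g\<close> vanishes almost everywhere.\<close>

definition ess_supp :: "(real ^ 'd \<Rightarrow> complex) \<Rightarrow> (real ^ 'd) set" where
  "ess_supp g = - \<Union>{U. open U \<and> (AE \<xi> in lborel. \<xi> \<in> U \<longrightarrow> g \<xi> = 0)}"

definition dual_cone :: "(real ^ 'd) set \<Rightarrow> (real ^ 'd) set" where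
  "dual_cone \<Omega> = {\<xi>. \<forall>x\<in>\<Omega>. 0 \<le> x \<bullet> \<xi>}"

definition tube :: "(real ^ 'd) set \<Rightarrow> (complex ^ 'd) set" where
  "tube \<Omega> = {z. (\<chi> j. Im (z $ j)) \<in> \<Omega>}"

definition slice :: "(complex ^ 'd \<Rightarrow> complex) \<Rightarrow> real ^ 'd \<Rightarrow> real ^ 'd \<Rightarrow> complex" where
  "slice F y x = F (\<chi> j. Complex (x $ j) (y $ j))"

definition pairing :: "complex ^ 'd \<Rightarrow> real ^ 'd \<Rightarrow> complex" where
  "pairing z \<xi> = (\<Sum>j\<in>UNIV. z $ j * complex_of_real (\<xi> $ j))"

definition holomorphic_Cn :: "(complex ^ 'd \<Rightarrow> complex) \<Rightarrow> (complex ^ 'd) set \<Rightarrow> bool" where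
  "holomorphic_Cn F U \<longleftrightarrow>
     (\<forall>z\<in>U. \<exists>D. (F has_derivative D) (at z) \<and> (\<forall>c v. D (c *s v) = c * D v))"

definition weight :: "(real ^ 'd \<Rightarrow> real) \<Rightarrow> nat \<Rightarrow> real ^ 'd \<Rightarrow> real" where
  "weight \<rho> n \<xi> = (\<Sum>k=0..n. \<rho> \<xi> ^ (2 * k))"

definition L2_weighted ::
    "(real ^ 'd) set \<Rightarrow> (real ^ 'd \<Rightarrow> real) \<Rightarrow> (real ^ 'd \<Rightarrow> complex) set" where
  "L2_weighted C w = {f. set_borel_measurable lborel C f \<and>
     set_integrable lborel C (\<lambda>\<xi>. (cmod (f \<xi>))\<^sup>2 * w \<xi>)}"

definition L2_weighted_norm ::
    "(real ^ 'd) set \<Rightarrow> (real ^ 'd \<Rightarrow> real) \<Rightarrow> (real ^ 'd \<Rightarrow> complex) \<Rightarrow> real" where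
  "L2_weighted_norm C w f = sqrt (\<integral>\<xi>\<in>C. (cmod (f \<xi>))\<^sup>2 * w \<xi> \<partial>lborel)"

text \<open>
  Common form of the two Hardy spaces: domain \<open>T\<close>, spectral cone \<open>C\<close>, weight \<open>w\<close>. Functions on \<open>T\<close>
  are extensional, so that equality in HOL is equality on \<open>T\<close>.
\<close>

definition represents ::
    "(complex ^ 'd) set \<Rightarrow> (real ^ 'd) set \<Rightarrow> (real ^ 'd \<Rightarrow> complex) \<Rightarrow>
     (complex ^ 'd \<Rightarrow> complex) \<Rightarrow> bool" where
  "represents T C f F \<longleftrightarrow> (\<forall>z\<in>T. F z = (\<integral>\<xi>\<in>C. exp (\<i> * pairing z \<xi>) * f \<xi> \<partial>lborel))"

definition spectral_space ::
    "(complex ^ 'd) set \<Rightarrow> (real ^ 'd) set \<Rightarrow> (real ^ 'd \<Rightarrow> real) \<Rightarrow>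
     (complex ^ 'd \<Rightarrow> complex) set" where
  "spectral_space T C w =
     {F \<in> extensional T. holomorphic_Cn F T \<and> (\<exists>f \<in> L2_weighted C w. represents T C f F)}"

definition spectral_norm ::
    "(complex ^ 'd) set \<Rightarrow> (real ^ 'd) set \<Rightarrow> (real ^ 'd \<Rightarrow> real) \<Rightarrow>
     (complex ^ 'd \<Rightarrow> complex) \<Rightarrow> real" where
  "spectral_norm T C w F =
     Inf (L2_weighted_norm C w ` {f \<in> L2_weighted C w. represents T C f F})"

definition H_plus ::
    "nat \<Rightarrow> (real ^ 'd \<Rightarrow> real) \<Rightarrow> (real ^ 'd) set \<Rightarrow> (complex ^ 'd \<Rightarrow> complex) set" where
  "H_plus n \<rho> \<Omega> = spectral_space (tube \<Omega>) (dual_cone \<Omega>) (weight \<rho> n)"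

definition H_plus_norm ::
    "nat \<Rightarrow> (real ^ 'd \<Rightarrow> real) \<Rightarrow> (real ^ 'd) set \<Rightarrow> (complex ^ 'd \<Rightarrow> complex) \<Rightarrow> real" where
  "H_plus_norm n \<rho> \<Omega> = spectral_norm (tube \<Omega>) (dual_cone \<Omega>) (weight \<rho> n)"

definition H_minus ::
    "nat \<Rightarrow> (real ^ 'd \<Rightarrow> real) \<Rightarrow> (real ^ 'd) set \<Rightarrow> (complex ^ 'd \<Rightarrow> complex) set" where
  "H_minus n \<rho> \<Omega> =
     spectral_space (tube (uminus ` \<Omega>)) (uminus ` dual_cone \<Omega>) (\<lambda>\<eta>. weight \<rho> n (- \<eta>))"

definition H_minus_norm ::
    "nat \<Rightarrow> (real ^ 'd \<Rightarrow> real) \<Rightarrow> (real ^ 'd) set \<Rightarrow> (complex ^ 'd \<Rightarrow> complex) \<Rightarrow> real" where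
  "H_minus_norm n \<rho> \<Omega> =
     spectral_norm (tube (uminus ` \<Omega>)) (uminus ` dual_cone \<Omega>) (\<lambda>\<eta>. weight \<rho> n (- \<eta>))"

definition sym_cone :: "(real ^ 'd) set \<Rightarrow> (real ^ 'd) set" where
  "sym_cone \<Omega> = dual_cone \<Omega> \<union> uminus ` dual_cone \<Omega>"

definition sym_weight ::
    "nat \<Rightarrow> (real ^ 'd \<Rightarrow> real) \<Rightarrow> (real ^ 'd) set \<Rightarrow> real ^ 'd \<Rightarrow> real" where
  "sym_weight n \<rho> \<Omega> \<xi> = (if \<xi> \<in> dual_cone \<Omega> then weight \<rho> n \<xi> else weight \<rho> n (- \<xi>))"

definition W_space ::
    "nat \<Rightarrow> (real ^ 'd \<Rightarrow> real) \<Rightarrow> (real ^ 'd) set \<Rightarrow> (real ^ 'd \<Rightarrow> complex) set" where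
  "W_space n \<rho> \<Omega> = {u \<in> L2. ess_supp (fourier_L2 u) \<subseteq> sym_cone \<Omega> \<and>
     fourier_L2 u \<in> L2_weighted (sym_cone \<Omega>) (sym_weight n \<rho> \<Omega>)}"

definition W_norm ::
    "nat \<Rightarrow> (real ^ 'd \<Rightarrow> real) \<Rightarrow> (real ^ 'd) set \<Rightarrow> (real ^ 'd \<Rightarrow> complex) \<Rightarrow> real" where
  "W_norm n \<rho> \<Omega> u = L2_weighted_norm (sym_cone \<Omega>) (sym_weight n \<rho> \<Omega>) (fourier_L2 u)"

text \<open>
  The library's \<^const>\<open>cone\<close> also demands closure under multiplication by 0, which no open
  set other than the empty set and the whole space satisfies; hence only positive factors here.
\<close>

definition open_convex_cone :: "(real ^ 'd) set \<Rightarrow> bool" where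
  "open_convex_cone \<Omega> \<longleftrightarrow> open \<Omega> \<and> convex \<Omega> \<and> (\<forall>x\<in>\<Omega>. \<forall>t>0. t *\<^sub>R x \<in> \<Omega>)"

definition contains_line :: "(real ^ 'd) set \<Rightarrow> bool" where
  "contains_line S \<longleftrightarrow> (\<exists>a v. v \<noteq> 0 \<and> (\<forall>t::real. a + t *\<^sub>R v \<in> S))"

end

theory Submission
  imports Defs "HOL-Probability.Characteristic_Functions" "HOL-Probability.Sinc_Integral"
begin

text \<open>
  Everything happens on the Fourier side. If \<open>F\<close> is represented by a density \<open>f\<close> supported in the dual
  cone, then \<open>F(x + iy) = \<integral> e\<^bsup>i\<langle>x,\<xi>\<rangle>\<^esup> e\<^bsup>-\<langle>y,\<xi>\<rangle>\<^esup> f(\<xi>) d\<xi>\<close>, so the slice at height \<open>y\<close> is the inverse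
  Fourier transform of the damped density \<open>e\<^bsup>-\<langle>y,\<xi>\<rangle>\<^esup> f(\<xi>)\<close>. As \<open>\<Omega>\<close> is open, \<open>\<langle>y,\<xi>\<rangle>\<close> dominates a multiple of
  \<open>|\<xi>|\<close> on the dual cone (\<open>dual_cone_coercive\<close>). Hence the damped density is integrable as well as square
  integrable, and the integral may be differentiated in \<open>z\<close> (\<open>laplace_has_derivative\<close>). As \<open>y \<rightarrow> 0\<close>
  in \<open>\<Omega>\<close>, the damped densities converge to \<open>f\<close> in \<open>L\<^sup>2\<close> by dominated convergence.

  Plancherel's theorem now says that the \<open>L\<^sup>2\<close> distance between a slice and \<open>u\<close> is a fixed multiple of
  the distance between the damped density and the transform of \<open>u\<close>. Therefore the slices tend to \<open>u\<close>
  if and only if \<open>f\<close> equals the transform of \<open>u\<close> almost everywhere (\<open>boundary_value_iff\<close>). This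
  equivalence carries the theorem. Existence: take the spectral component as density. Uniqueness: the
  boundary value determines the density up to a null set, hence the function. Norm: all representing
  densities agree almost everywhere on the cone, so the infimum that defines the norm of \<open>F\<close> is the
  weighted norm of the spectral component. The claims about \<open>F\<^sub>-\<close> are the same statements for the cone
  \<open>-\<Omega>\<close>, whose dual cone is \<open>-\<Omega>\<^sup>*\<close>. As the two dual cones meet only at the null set \<open>{0}\<close> and the transform of
  \<open>u\<close> vanishes almost everywhere off their union, the transform of \<open>u\<close> is the sum of its two
  components and the weighted integral splits; injectivity of the Fourier transform on \<open>L\<^sup>2\<close> gives
  \<open>u = u\<^sub>+ + u\<^sub>-\<close>.

  The analytic input is Plancherel's theorem in \<open>d\<close> dimensions. For \<open>v\<close> in \<open>L\<^sup>1 \<inter> L\<^sup>2\<close>, the function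
  \<open>|FT v|\<^sup>2\<close> is the transform of the autocorrelation of \<open>v\<close>. Integrated against a wide Gaussian it becomes
  the autocorrelation averaged over a narrow Gaussian around \<open>0\<close>. The autocorrelation is continuous at
  \<open>0\<close>, where its value is the squared \<open>L\<^sup>2\<close> norm of \<open>v\<close>; letting the width grow gives the identity
  (\<open>plancherel\<close>). The identity extends to \<open>L\<^sup>2\<close> by completeness. In place of an inversion theorem,
  \<open>L2_norm_IFT_diff\<close> compares an inverse transform with a given function directly.
\<close>

section \<open>Lebesgue integrals on Euclidean spaces\<close>

lemma lborel_integral_scaleR:
  fixes f :: "'a::euclidean_space \<Rightarrow> 'b::{banach, second_countable_topology}"
  assumes c: "c \<noteq> 0" and [measurable]: "f \<in> borel_measurable borel"
  shows "(\<integral>x. f x \<partial>lborel) = \<bar>c\<bar> ^ DIM('a) *\<^sub>R (\<integral>x. f (t + c *\<^sub>R x) \<partial>lborel)"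
  by (subst lborel_affine[OF c, of t]) (simp add: integral_density integral_distr)

lemma lborel_integrable_scaleR:
  fixes f :: "'a::euclidean_space \<Rightarrow> 'b::{banach, second_countable_topology}"
  assumes c: "c \<noteq> 0" and f: "integrable lborel f"
  shows "integrable lborel (\<lambda>x. f (t + c *\<^sub>R x))"
proof -
  have [measurable]: "f \<in> borel_measurable borel" using f by auto
  have "integrable (density (distr lborel borel (\<lambda>x. t + c *\<^sub>R x)) (\<lambda>_. ennreal (\<bar>c\<bar>^DIM('a)))) f"
    using f by (subst (asm) lborel_affine[OF c, of t]) (simp add: ennreal_power)
  then have "integrable lborel (\<lambda>x. \<bar>c\<bar> ^ DIM('a) *\<^sub>R f (t + c *\<^sub>R x))"
    by (subst (asm) integrable_density) (auto simp: integrable_distr_eq)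
  then have "integrable lborel (\<lambda>x. inverse (\<bar>c\<bar> ^ DIM('a)) *\<^sub>R \<bar>c\<bar> ^ DIM('a) *\<^sub>R f (t + c *\<^sub>R x))"
    by (rule integrable_scaleR_right[OF _])
  moreover have "inverse (\<bar>c\<bar> ^ DIM('a)) *\<^sub>R \<bar>c\<bar> ^ DIM('a) *\<^sub>R f (t + c *\<^sub>R x) = f (t + c *\<^sub>R x)" for x
    using c by simp
  ultimately show ?thesis by (simp only:)
qed

lemma
  fixes f :: "'a::euclidean_space \<Rightarrow> real \<Rightarrow> 'b::{real_normed_field, banach, second_countable_topology}"
  assumes f: "\<And>b. b \<in> Basis \<Longrightarrow> integrable lborel (f b)"
  shows integrable_lborel_prod: "integrable lborel (\<lambda>x::'a. \<Prod>b\<in>Basis. f b (x \<bullet> b))"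
    and integral_lborel_prod:
      "(\<integral>x. (\<Prod>b\<in>Basis. f b ((x::'a) \<bullet> b)) \<partial>lborel) = (\<Prod>b\<in>Basis. (\<integral>t. f b t \<partial>lborel))"
proof -
  interpret product_sigma_finite "\<lambda>_::'a. lborel :: real measure" ..
  have [measurable]: "f b \<in> borel_measurable borel" if "b \<in> Basis" for b
    using f[OF that] by auto
  have eq: "(\<Prod>b\<in>Basis. f b ((\<Sum>b\<in>Basis. g b *\<^sub>R b) \<bullet> b)) = (\<Prod>b\<in>Basis. f b (g b))" for g :: "'a \<Rightarrow> real"
    by (intro prod.cong) auto
  show "integrable lborel (\<lambda>x::'a. \<Prod>b\<in>Basis. f b (x \<bullet> b))"
    by (subst lborel_eq) (simp add: integrable_distr_eq eq product_integrable_prod f)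
  show "(\<integral>x. (\<Prod>b\<in>Basis. f b ((x::'a) \<bullet> b)) \<partial>lborel) = (\<Prod>b\<in>Basis. (\<integral>t. f b t \<partial>lborel))"
    by (subst lborel_eq) (simp add: integral_distr eq product_integral_prod f)
qed

section \<open>The Gaussian and its Fourier transform\<close>

definition gauss :: "'a::euclidean_space \<Rightarrow> real" where
  "gauss x = exp (- (norm x)\<^sup>2 / 2)"

lemma gauss_measurable [measurable]: "gauss \<in> borel_measurable borel"
  unfolding gauss_def by measurable

lemma gauss_pos: "0 < gauss x"
  by (simp add: gauss_def)

lemma gauss_prod: "gauss (x::'a::euclidean_space) = (\<Prod>b\<in>Basis. gauss (x \<bullet> b))"
proof -
  have "(norm x)\<^sup>2 = (\<Sum>b\<in>Basis. (x \<bullet> b)\<^sup>2)"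
    unfolding power2_norm_eq_inner by (subst euclidean_inner) (simp only: power2_eq_square)
  then show ?thesis
    unfolding gauss_def by (simp add: exp_sum[symmetric] sum_negf[symmetric] sum_divide_distrib)
qed

lemma gauss_real: "gauss (t::real) = sqrt (2 * pi) * std_normal_density t"
  by (simp add: gauss_def std_normal_density_def)

lemma integrable_gauss: "integrable lborel (gauss :: 'a::euclidean_space \<Rightarrow> real)"
proof -
  have "integrable lborel (gauss :: real \<Rightarrow> real)"
    unfolding gauss_real[abs_def] by simp
  then show ?thesis
    unfolding gauss_prod[abs_def, where ?'a='a]
    using integrable_lborel_prod[of "\<lambda>_. gauss :: real \<Rightarrow> real"] by simp
qed

text \<open>
  Without the factor \<open>(2\<pi>)\<^sup>-\<^sup>d\<close> of \<^const>\<open>fourier\<close>, so that the same integral also serves, after a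
  reflection, as the inverse transform.
\<close>

definition FT :: "('a::euclidean_space \<Rightarrow> complex) \<Rightarrow> 'a \<Rightarrow> complex" where
  "FT v \<xi> = (\<integral>x. v x * exp (- \<i> * complex_of_real (x \<bullet> \<xi>)) \<partial>lborel)"

text \<open>
  The characteristic function of the standard normal distribution is the case of dimension one; both
  the Gaussian and the character are products over the coordinates.
\<close>

lemma FT_gauss:
  "FT (\<lambda>x. complex_of_real (gauss x)) (\<xi>::'a::euclidean_space) = of_real (sqrt (2 * pi) ^ DIM('a) * gauss \<xi>)"
proof -
  have int1: "integrable lborel (\<lambda>x::real. complex_of_real (gauss x) * exp (- \<i> * of_real (x * t)))" for t :: real
  proof (rule Bochner_Integration.integrable_bound)
    show "integrable lborel (gauss :: real \<Rightarrow> real)" by (rule integrable_gauss)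
    show "AE x in lborel. norm (complex_of_real (gauss x) * exp (- \<i> * of_real (x * t))) \<le> norm (gauss x)"
      by (simp add: norm_mult)
  qed simp
  have one: "(\<integral>x. complex_of_real (gauss (x::real)) * exp (- \<i> * of_real (x * t)) \<partial>lborel) = of_real (sqrt (2 * pi) * gauss t)" for t :: real
  proof -
    have "char std_normal_distribution (- t) = (\<integral>x. std_normal_density x *\<^sub>R exp (\<i> * of_real (- t * x)) \<partial>lborel)"
      unfolding char_def by (subst integral_density) (auto simp: normal_density_nonneg)
    then have "(\<integral>x. std_normal_density x *\<^sub>R exp (\<i> * of_real (- t * x)) \<partial>lborel) = gauss t"
      unfolding char_std_normal_distribution by (simp add: gauss_def)
    then have "of_real (sqrt (2 * pi)) * (\<integral>x. std_normal_density x *\<^sub>R exp (\<i> * of_real (- t * x)) \<partial>lborel)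
      = of_real (sqrt (2 * pi) * gauss t)" by simp
    then show ?thesis
      by (simp add: integral_mult_right_zero[symmetric] gauss_real scaleR_conv_of_real mult_ac del: integral_mult_right_zero)
  qed
  have "complex_of_real (gauss x) * exp (- \<i> * of_real (x \<bullet> \<xi>)) =
      (\<Prod>b\<in>Basis. complex_of_real (gauss (x \<bullet> b)) * exp (- \<i> * of_real ((x \<bullet> b) * (\<xi> \<bullet> b))))" for x :: 'a
    by (subst gauss_prod, subst euclidean_inner) (simp add: prod.distrib exp_sum sum_distrib_left sum_negf[symmetric])
  then have "FT (\<lambda>x. complex_of_real (gauss x)) \<xi> = (\<Prod>b\<in>Basis. of_real (sqrt (2 * pi) * gauss (\<xi> \<bullet> b)))"
    unfolding FT_def using integral_lborel_prod[of "\<lambda>(b::'a) t. complex_of_real (gauss t) * exp (- \<i> * of_real (t * (\<xi> \<bullet> b)))"] int1 one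
    by simp
  also have "\<dots> = of_real (sqrt (2 * pi) ^ DIM('a) * gauss \<xi>)"
    by (subst (2) gauss_prod) (simp add: prod.distrib)
  finally show ?thesis .
qed

lemma integral_gauss: "(\<integral>x. gauss (x::'a::euclidean_space) \<partial>lborel) = sqrt (2 * pi) ^ DIM('a)"
proof -
  have "of_real (\<integral>x. gauss (x::'a) \<partial>lborel) = FT (\<lambda>x. complex_of_real (gauss x)) (0::'a)"
    by (simp add: FT_def)
  also have "\<dots> = of_real (sqrt (2 * pi) ^ DIM('a))"
    by (simp only: FT_gauss) (simp add: gauss_def)
  finally show ?thesis by (simp only: of_real_eq_iff)
qed

section \<open>Fubini's theorem and the Fourier transform\<close>

lemma FT_measurable [measurable]:
  assumes [measurable]: "v \<in> borel_measurable borel"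
  shows "FT v \<in> borel_measurable borel"
  unfolding FT_def by measurable

lemma integrable_mult_cis:
  fixes v :: "'a \<Rightarrow> complex" and p :: "'a \<Rightarrow> real"
  assumes v: "integrable M v" and [measurable]: "p \<in> borel_measurable M"
  shows "integrable M (\<lambda>x. v x * exp (- \<i> * complex_of_real (p x)))"
    "integrable M (\<lambda>x. v x * exp (\<i> * complex_of_real (p x)))"
proof -
  have [measurable]: "v \<in> borel_measurable M" using v by auto
  show "integrable M (\<lambda>x. v x * exp (- \<i> * complex_of_real (p x)))"
    by (rule Bochner_Integration.integrable_bound[OF v]) (auto simp: norm_mult)
  show "integrable M (\<lambda>x. v x * exp (\<i> * complex_of_real (p x)))"
    by (rule Bochner_Integration.integrable_bound[OF v]) (auto simp: norm_mult)
qed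

lemma integrable_tensor:
  fixes f g :: "'a::euclidean_space \<Rightarrow> complex"
  assumes f: "integrable lborel f" and g: "integrable lborel g"
  shows "integrable (lborel \<Otimes>\<^sub>M lborel) (\<lambda>(x, y). f x * g y)"
proof (rule lborel_pair.Fubini_integrable)
  have [measurable]: "f \<in> borel_measurable borel" "g \<in> borel_measurable borel" using f g by auto
  show "(\<lambda>(x, y). f x * g y) \<in> borel_measurable (lborel \<Otimes>\<^sub>M lborel)" by measurable
qed (use f g in \<open>auto simp: norm_mult\<close>)

text \<open>
  The character is symmetric in its two arguments, so Fubini's theorem moves the transform from one
  factor to the other.
\<close>

lemma FT_multiplication:
  assumes v: "integrable lborel v" and h: "integrable lborel h"
  shows "(\<integral>\<xi>. FT v \<xi> * h \<xi> \<partial>lborel) = (\<integral>x. v x * FT h x \<partial>lborel)"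
proof -
  have [measurable]: "v \<in> borel_measurable borel" "h \<in> borel_measurable borel" using v h by auto
  have int: "integrable (lborel \<Otimes>\<^sub>M lborel) (\<lambda>(x, y). v x * h y * exp (- \<i> * complex_of_real (x \<bullet> y)))"
    using integrable_mult_cis(1)[OF integrable_tensor[OF v h], of "\<lambda>(x,y). x \<bullet> y"]
    by (simp add: case_prod_unfold)
  have "(\<integral>\<xi>. FT v \<xi> * h \<xi> \<partial>lborel) = (\<integral>\<xi>. (\<integral>x. v x * h \<xi> * exp (- \<i> * complex_of_real (x \<bullet> \<xi>)) \<partial>lborel) \<partial>lborel)"
    unfolding FT_def by (simp add: integral_mult_left_zero[symmetric] mult_ac del: integral_mult_left_zero)
  also have "\<dots> = (\<integral>x. (\<integral>\<xi>. v x * h \<xi> * exp (- \<i> * complex_of_real (x \<bullet> \<xi>)) \<partial>lborel) \<partial>lborel)"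
    by (rule lborel_pair.Fubini_integral[OF int])
  also have "\<dots> = (\<integral>x. v x * FT h x \<partial>lborel)"
    unfolding FT_def by (simp add: integral_mult_right_zero[symmetric] mult_ac inner_commute del: integral_mult_right_zero)
  finally show ?thesis .
qed

lemma lborel_integral_translate:
  fixes f :: "'a::euclidean_space \<Rightarrow> 'b::{banach, second_countable_topology}"
  assumes [measurable]: "f \<in> borel_measurable borel"
  shows "(\<integral>x. f (x + t) \<partial>lborel) = (\<integral>x. f x \<partial>lborel)"
  using lborel_integral_scaleR[of 1 f t] by (simp add: add.commute)

lemma lborel_integrable_translate:
  fixes f :: "'a::euclidean_space \<Rightarrow> 'b::{banach, second_countable_topology}"
  assumes "integrable lborel f"
  shows "integrable lborel (\<lambda>x. f (x + t))"
  using lborel_integrable_scaleR[of 1 f t] assms by (simp add: add.commute)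

lemma lborel_integral_reflect:
  fixes f :: "'a::euclidean_space \<Rightarrow> 'b::{banach, second_countable_topology}"
  assumes [measurable]: "f \<in> borel_measurable borel"
  shows "(\<integral>x. f (t - x) \<partial>lborel) = (\<integral>x. f x \<partial>lborel)"
  using lborel_integral_scaleR[of "-1" f t] by simp

lemma lborel_integrable_reflect:
  fixes f :: "'a::euclidean_space \<Rightarrow> 'b::{banach, second_countable_topology}"
  assumes "integrable lborel f"
  shows "integrable lborel (\<lambda>x. f (t - x))"
  using lborel_integrable_scaleR[of "-1" f t] assms by simp

section \<open>Continuity of translations in \<open>L\<^sup>1\<close>\<close>

lemma translation_dist_le:
  fixes f g :: "'a::euclidean_space \<Rightarrow> 'b::{banach, second_countable_topology}"
  assumes f: "integrable lborel f" and g: "integrable lborel g"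
  shows "(\<integral>x. norm (f (x + t) - f x) \<partial>lborel)
    \<le> 2 * (\<integral>x. norm (f x - g x) \<partial>lborel) + (\<integral>x. norm (g (x + t) - g x) \<partial>lborel)"
proof -
  note [measurable] = borel_measurable_integrable[OF f, simplified] borel_measurable_integrable[OF g, simplified]
  note i = lborel_integrable_translate[OF f, of t] lborel_integrable_translate[OF g, of t] f g
  have "(\<integral>x. norm (f (x + t) - f x) \<partial>lborel) \<le>
      (\<integral>x. norm (f (x + t) - g (x + t)) + norm (f x - g x) + norm (g (x + t) - g x) \<partial>lborel)"
  proof (rule integral_mono)
    fix x
    have "f (x + t) - f x = (f (x + t) - g (x + t)) + - (f x - g x) + (g (x + t) - g x)" by simp
    then show "norm (f (x + t) - f x) \<le> norm (f (x + t) - g (x + t)) + norm (f x - g x) + norm (g (x + t) - g x)"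
      by (metis norm_minus_cancel norm_triangle_le add_right_mono norm_triangle_ineq)
  qed (use i in auto)
  also have "\<dots> = (\<integral>x. norm (f (x + t) - g (x + t)) \<partial>lborel) + (\<integral>x. norm (f x - g x) \<partial>lborel)
      + (\<integral>x. norm (g (x + t) - g x) \<partial>lborel)"
    using i by simp
  also have "(\<integral>x. norm (f (x + t) - g (x + t)) \<partial>lborel) = (\<integral>x. norm (f x - g x) \<partial>lborel)"
    by (rule lborel_integral_translate[of "\<lambda>x. norm (f x - g x)"]) measurable
  finally show ?thesis by simp
qed

text \<open>
  Translations are isometries, so continuity under translation passes to \<open>L\<^sup>1\<close> limits.
\<close>

lemma translation_dist_limit:
  fixes f :: "'a::euclidean_space \<Rightarrow> 'b::{banach, second_countable_topology}" and s :: "nat \<Rightarrow> 'a"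
  assumes f: "integrable lborel f"
    and approx: "\<And>e. e > 0 \<Longrightarrow> \<exists>g. integrable lborel g \<and> (\<integral>x. norm (f x - g x) \<partial>lborel) < e \<and>
      (\<lambda>k. \<integral>x. norm (g (x + s k) - g x) \<partial>lborel) \<longlonglongrightarrow> 0"
  shows "(\<lambda>k. \<integral>x. norm (f (x + s k) - f x) \<partial>lborel) \<longlonglongrightarrow> 0"
proof (rule LIMSEQ_I)
  fix r :: real assume r: "0 < r"
  obtain g where g: "integrable lborel g" "(\<integral>x. norm (f x - g x) \<partial>lborel) < r / 4"
    and lim: "(\<lambda>k. \<integral>x. norm (g (x + s k) - g x) \<partial>lborel) \<longlonglongrightarrow> 0"
    using approx[of "r / 4"] r by auto
  from LIMSEQ_D[OF lim, of "r / 2"] r obtain N where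
    N: "\<And>k. k \<ge> N \<Longrightarrow> (\<integral>x. norm (g (x + s k) - g x) \<partial>lborel) < r / 2"
    by auto
  show "\<exists>N. \<forall>k\<ge>N. norm ((\<integral>x. norm (f (x + s k) - f x) \<partial>lborel) - 0) < r"
  proof (intro exI allI impI)
    fix k assume "N \<le> k"
    with N have "(\<integral>x. norm (f (x + s k) - f x) \<partial>lborel) < r"
      using translation_dist_le[OF f g(1), of "s k"] g(2) by fastforce
    then show "norm ((\<integral>x. norm (f (x + s k) - f x) \<partial>lborel) - 0) < r" by simp
  qed
qed

text \<open>
  A point of an open set stays in it under small translations, so the part of \<open>U\<close> lost by translation
  tends to measure zero by dominated convergence. The part gained has the same measure as the part
  lost, because translations preserve the measure of \<open>U\<close>.
\<close>

lemma translation_open: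
  fixes U :: "'a::euclidean_space set" and s :: "nat \<Rightarrow> 'a"
  assumes U: "open U" "emeasure lborel U < \<infinity>" and s: "s \<longlonglongrightarrow> 0"
  shows "(\<lambda>k. \<integral>x. norm (indicator U (x + s k) - indicator U x :: real) \<partial>lborel) \<longlonglongrightarrow> 0"
proof -
  let ?I = "indicator U :: 'a \<Rightarrow> real"
  have [measurable]: "U \<in> sets borel" using U by auto
  have i: "integrable lborel ?I" using U by (auto simp: integrable_indicator_iff)
  have pos: "(\<lambda>k. \<integral>x. max 0 (?I x - ?I (x + s k)) \<partial>lborel) \<longlonglongrightarrow> (\<integral>x. 0 \<partial>(lborel :: 'a measure))"
  proof (rule integral_dominated_convergence[where w="?I"])
    show "AE x in lborel. (\<lambda>k. max 0 (?I x - ?I (x + s k))) \<longlonglongrightarrow> 0"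
    proof (rule AE_I2)
      fix x
      show "(\<lambda>k. max 0 (?I x - ?I (x + s k))) \<longlonglongrightarrow> 0"
      proof (cases "x \<in> U")
        case True
        have "(\<lambda>k. x + s k) \<longlonglongrightarrow> x + 0" by (intro tendsto_intros s)
        then have "\<forall>\<^sub>F k in sequentially. x + s k \<in> U"
          using topological_tendstoD[of _ x] U True by auto
        then have "\<forall>\<^sub>F k in sequentially. max 0 (?I x - ?I (x + s k)) = 0"
          by eventually_elim (simp add: indicator_def)
        then show ?thesis by (rule tendsto_eventually)
      qed (simp add: indicator_def)
    qed
  qed (use i in \<open>auto simp: indicator_def\<close>)
  have "(\<integral>x. norm (?I (x + t) - ?I x) \<partial>lborel) = 2 * (\<integral>x. max 0 (?I x - ?I (x + t)) \<partial>lborel)" for t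
  proof -
    note it = lborel_integrable_translate[OF i, of t]
    have im: "integrable lborel (\<lambda>x. max 0 (?I x - ?I (x + t)))"
      by (rule Bochner_Integration.integrable_bound[OF i]) (auto simp: indicator_def)
    have "(\<integral>x. norm (?I (x + t) - ?I x) \<partial>lborel) = (\<integral>x. 2 * max 0 (?I x - ?I (x + t)) + (?I (x + t) - ?I x) \<partial>lborel)"
      by (rule Bochner_Integration.integral_cong) (auto simp: indicator_def)
    also have "\<dots> = 2 * (\<integral>x. max 0 (?I x - ?I (x + t)) \<partial>lborel) + ((\<integral>x. ?I (x + t) \<partial>lborel) - (\<integral>x. ?I x \<partial>lborel))"
      using i it im by simp
    also have "(\<integral>x. ?I (x + t) \<partial>lborel) = (\<integral>x. ?I x \<partial>lborel)"
      by (rule lborel_integral_translate) measurable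
    finally show ?thesis by simp
  qed
  then show ?thesis using tendsto_mult_left[OF pos, of 2] by simp
qed

text \<open>
  Indicators of sets of finite measure are approximated by those of open sets, by outer regularity;
  the general case follows by linearity and limits.
\<close>

lemma translation_L1:
  fixes f :: "'a::euclidean_space \<Rightarrow> 'b::{banach, second_countable_topology}" and s :: "nat \<Rightarrow> 'a"
  assumes "integrable lborel f" and s: "s \<longlonglongrightarrow> 0"
  shows "(\<lambda>k. \<integral>x. norm (f (x + s k) - f x) \<partial>lborel) \<longlonglongrightarrow> 0"
  using assms(1)
proof induct
  case (base A c)
  then have A[measurable]: "A \<in> sets borel" by simp
  have iA: "integrable lborel (\<lambda>x. indicator A x *\<^sub>R c)"
    using base by (auto simp: integrable_indicator_iff)
  show ?case
  proof (rule translation_dist_limit[OF iA])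
    fix e :: real assume e: "e > 0"
    \<comment> \<open>The summand 1 covers the case c = 0.\<close>
    obtain T where T: "open T" "A \<subseteq> T" "emeasure lebesgue (T - A) < ennreal (e / (norm c + 1))"
      using sets_lebesgue_outer_open[of A "e / (norm c + 1)"] A e
      by (metis add_nonneg_pos divide_pos_pos lborelD norm_ge_zero sets_completionI_sets sets_lborel zero_less_one)
    have [measurable]: "T \<in> sets borel" using T by auto
    have mTA: "emeasure lborel (T - A) < ennreal (e / (norm c + 1))" using T(3) by simp
    have "emeasure lborel T \<le> emeasure lborel A + emeasure lborel (T - A)"
      using T by (subst plus_emeasure) (auto intro!: emeasure_mono)
    also have "\<dots> < \<infinity>" using base mTA by (auto simp: less_top[symmetric] ennreal_add_eq_top)
    finally have fT: "emeasure lborel T < \<infinity>" .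
    have iT: "integrable lborel (\<lambda>x. indicator T x *\<^sub>R c)"
      using fT by (auto simp: integrable_indicator_iff)
    have "(\<integral>x. norm (indicator A x *\<^sub>R c - indicator T x *\<^sub>R c) \<partial>lborel) = (\<integral>x. indicator (T - A) x * norm c \<partial>lborel)"
      using T by (intro Bochner_Integration.integral_cong) (auto simp: indicator_def)
    also have "\<dots> = measure lborel (T - A) * norm c" by simp
    also have "\<dots> \<le> (e / (norm c + 1)) * norm c"
      using mTA e by (intro mult_right_mono) (auto simp: measure_def intro!: enn2real_leI)
    also have "\<dots> < e" using e by (simp add: field_simps add_pos_nonneg)
    finally have d: "(\<integral>x. norm (indicator A x *\<^sub>R c - indicator T x *\<^sub>R c) \<partial>lborel) < e" .
    have "(\<integral>x. norm (indicator T (x + t) *\<^sub>R c - indicator T x *\<^sub>R c) \<partial>lborel)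
        = (\<integral>x. norm (indicator T (x + t) - indicator T x :: real) \<partial>lborel) * norm c" for t
      by (simp add: scaleR_diff_left[symmetric])
    then have "(\<lambda>k. \<integral>x. norm (indicator T (x + s k) *\<^sub>R c - indicator T x *\<^sub>R c) \<partial>lborel) \<longlonglongrightarrow> 0"
      using tendsto_mult_right[OF translation_open[OF T(1) fT s], of "norm c"] by simp
    with iT d show "\<exists>g. integrable lborel g \<and> (\<integral>x. norm (indicator A x *\<^sub>R c - g x) \<partial>lborel) < e \<and>
      (\<lambda>k. \<integral>x. norm (g (x + s k) - g x) \<partial>lborel) \<longlonglongrightarrow> 0" by blast
  qed
next
  case (add f g)
  note i = add(1,3) lborel_integrable_translate[OF add(1)] lborel_integrable_translate[OF add(3)]
  show ?case
  proof (rule tendsto_sandwich[OF _ _ tendsto_const])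
    show "(\<lambda>k. (\<integral>x. norm (f (x + s k) - f x) \<partial>lborel) + (\<integral>x. norm (g (x + s k) - g x) \<partial>lborel)) \<longlonglongrightarrow> 0"
      using tendsto_add[OF add(2,4)] by simp
    have "(\<integral>x. norm (f (x + s k) + g (x + s k) - (f x + g x)) \<partial>lborel)
      \<le> (\<integral>x. norm (f (x + s k) - f x) + norm (g (x + s k) - g x) \<partial>lborel)" for k
      using i by (intro integral_mono) (auto intro: norm_diff_triangle_ineq)
    then show "\<forall>\<^sub>F k in sequentially. (\<integral>x. norm (f (x + s k) + g (x + s k) - (f x + g x)) \<partial>lborel)
      \<le> (\<integral>x. norm (f (x + s k) - f x) \<partial>lborel) + (\<integral>x. norm (g (x + s k) - g x) \<partial>lborel)"
      using i by simp
  qed simp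
next
  case (lim f g)
  note [measurable] = borel_measurable_integrable[OF lim(1), simplified] borel_measurable_integrable[OF lim(5), simplified]
  show ?case
  proof (rule translation_dist_limit[OF lim(5)])
    fix e :: real assume e: "e > 0"
    have "(\<lambda>i. \<integral>x. norm (f x - g i x) \<partial>lborel) \<longlonglongrightarrow> (\<integral>x. 0 \<partial>(lborel :: 'a measure))"
    proof (rule integral_dominated_convergence[where w="\<lambda>x. 3 * norm (f x)"])
      show "AE x in lborel. (\<lambda>i. norm (f x - g i x)) \<longlonglongrightarrow> 0"
      proof (rule AE_I2)
        fix x
        have "(\<lambda>i. norm (f x - g i x)) \<longlonglongrightarrow> norm (f x - f x)"
          by (intro tendsto_intros lim(3)) simp
        then show "(\<lambda>i. norm (f x - g i x)) \<longlonglongrightarrow> 0" by simp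
      qed
      show "AE x in lborel. norm (norm (f x - g i x)) \<le> 3 * norm (f x)" for i
      proof (rule AE_I2)
        fix x
        have "norm (f x - g i x) \<le> norm (f x) + norm (g i x)" by (rule norm_triangle_ineq4)
        then show "norm (norm (f x - g i x)) \<le> 3 * norm (f x)" using lim(4)[of x i] by simp
      qed
    qed (use lim in auto)
    then have "\<forall>\<^sub>F i in sequentially. (\<integral>x. norm (f x - g i x) \<partial>lborel) < e"
      using e by (intro order_tendstoD) auto
    then obtain i where "(\<integral>x. norm (f x - g i x) \<partial>lborel) < e" by (auto simp: eventually_sequentially)
    then show "\<exists>g. integrable lborel g \<and> (\<integral>x. norm (f x - g x) \<partial>lborel) < e \<and>
      (\<lambda>k. \<integral>x. norm (g (x + s k) - g x) \<partial>lborel) \<longlonglongrightarrow> 0"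
      using lim(1,2) by blast
  qed
qed

section \<open>Plancherel's theorem on \<open>L\<^sup>1 \<inter> L\<^sup>2\<close>\<close>

definition autocorr :: "('a::euclidean_space \<Rightarrow> complex) \<Rightarrow> 'a \<Rightarrow> complex" where
  "autocorr v s = (\<integral>x. v x * cnj (v (x - s)) \<partial>lborel)"

lemma borel_measurable_cnj [measurable (raw)]:
  "f \<in> borel_measurable M \<Longrightarrow> (\<lambda>x. cnj (f x)) \<in> borel_measurable M"
  by (rule borel_measurable_continuous_on[OF continuous_on_cnj[OF continuous_on_id]])

lemma cmod_mult_le: "cmod (a * b) \<le> ((cmod a)\<^sup>2 + (cmod b)\<^sup>2) / 2"
  using sum_squares_bound[of "cmod a" "cmod b"] by (simp add: norm_mult)

lemma integrable_mult_L2: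
  fixes f g :: "'a \<Rightarrow> complex"
  assumes [measurable]: "f \<in> borel_measurable M" "g \<in> borel_measurable M"
    and f: "integrable M (\<lambda>x. (cmod (f x))\<^sup>2)" and g: "integrable M (\<lambda>x. (cmod (g x))\<^sup>2)"
  shows "integrable M (\<lambda>x. f x * g x)"
proof (rule Bochner_Integration.integrable_bound)
  show "integrable M (\<lambda>x. ((cmod (f x))\<^sup>2 + (cmod (g x))\<^sup>2) / 2)" using f g by simp
  show "AE x in M. norm (f x * g x) \<le> norm (((cmod (f x))\<^sup>2 + (cmod (g x))\<^sup>2) / 2)"
    using cmod_mult_le by (auto intro!: AE_I2)
qed simp

context
  fixes v :: "'a::euclidean_space \<Rightarrow> complex"
  assumes v: "integrable lborel v" and v2: "integrable lborel (\<lambda>x. (cmod (v x))\<^sup>2)"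
begin

lemma autocorr_arg_measurable [measurable]: "v \<in> borel_measurable borel" using v by auto

lemma integrable_translate_arg: "integrable lborel (\<lambda>x. v (x - s))" "integrable lborel (\<lambda>x. (cmod (v (x - s)))\<^sup>2)"
  using lborel_integrable_translate[OF v, of "-s"] lborel_integrable_translate[OF v2, of "-s"] by auto

lemma integral_translate_arg: "(\<integral>x. (cmod (v (x - s)))\<^sup>2 \<partial>lborel) = (\<integral>x. (cmod (v x))\<^sup>2 \<partial>lborel)"
  using lborel_integral_translate[of "\<lambda>x. (cmod (v x))\<^sup>2" "-s"] by simp

lemma autocorr_integrand: "integrable lborel (\<lambda>x. v x * cnj (v (x - s)))"
  by (rule integrable_mult_L2) (use v2 integrable_translate_arg(2) in auto)

lemma autocorr_bound: "cmod (autocorr v s) \<le> (\<integral>x. (cmod (v x))\<^sup>2 \<partial>lborel)"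
proof -
  have "cmod (autocorr v s) \<le> (\<integral>x. cmod (v x * cnj (v (x - s))) \<partial>lborel)"
    unfolding autocorr_def by (rule integral_norm_bound)
  also have "\<dots> \<le> (\<integral>x. ((cmod (v x))\<^sup>2 + (cmod (v (x - s)))\<^sup>2) / 2 \<partial>lborel)"
    using v2 integrable_translate_arg(2) autocorr_integrand
    using cmod_mult_le[of "v x" "cnj (v (x - s))" for x] by (intro integral_mono) auto
  also have "\<dots> = (\<integral>x. (cmod (v x))\<^sup>2 \<partial>lborel)"
    using v2 integrable_translate_arg(2)[of s] integral_translate_arg[of s] by simp
  finally show ?thesis .
qed

lemma autocorr_0: "autocorr v 0 = of_real (\<integral>x. (cmod (v x))\<^sup>2 \<partial>lborel)"
  unfolding autocorr_def by (simp add: complex_norm_square[symmetric] flip: of_real_power)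

text \<open>
  Where \<open>|v| \<le> N\<close> the increment is controlled by \<open>N\<close> times the \<open>L\<^sup>1\<close> distance of \<open>v\<close> to its translate.
  The remaining part of \<open>v\<close> has small \<open>L\<^sup>2\<close> norm for large \<open>N\<close>, and there the product is split by the
  inequality \<open>2ab \<le> a\<^sup>2/d + d b\<^sup>2\<close> with a small weight \<open>d\<close>.
\<close>

lemma autocorr_continuous:
  fixes s :: "nat \<Rightarrow> 'a"
  assumes s: "s \<longlonglongrightarrow> 0"
  shows "(\<lambda>k. autocorr v (s k)) \<longlonglongrightarrow> autocorr v 0"
proof (rule LIMSEQ_I)
  fix e :: real assume e: "0 < e"
  define V where "V = (\<integral>x. (cmod (v x))\<^sup>2 \<partial>lborel)"
  have V: "0 \<le> V" unfolding V_def by simp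
  \<comment> \<open>This makes 2 * d * V smaller than e / 3; V + 1 avoids a division by 0.\<close>
  define d where "d = e / (6 * (V + 1))"
  have d: "0 < d" "2 * d * V < e / 3" using e V by (auto simp: d_def field_simps)
  define r where "r N x = (if cmod (v x) \<le> real N then 0 else v x)" for N x
  have r[measurable]: "r N \<in> borel_measurable borel" for N unfolding r_def by measurable
  have r2: "integrable lborel (\<lambda>x. (cmod (r N x))\<^sup>2)" for N
    by (rule Bochner_Integration.integrable_bound[OF v2]) (auto simp: r_def)
  have "(\<lambda>N. \<integral>x. (cmod (r N x))\<^sup>2 \<partial>lborel) \<longlonglongrightarrow> (\<integral>x. 0 \<partial>(lborel :: 'a measure))"
  proof (rule integral_dominated_convergence[where w="\<lambda>x. (cmod (v x))\<^sup>2"])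
    show "AE x in lborel. (\<lambda>N. (cmod (r N x))\<^sup>2) \<longlonglongrightarrow> 0"
    proof (rule AE_I2)
      fix x
      have "\<forall>\<^sub>F N in sequentially. cmod (v x) \<le> real N"
        by (meson eventually_sequentiallyI nat_ceiling_le_eq)
      then have "\<forall>\<^sub>F N in sequentially. (cmod (r N x))\<^sup>2 = 0" by eventually_elim (simp add: r_def)
      then show "(\<lambda>N. (cmod (r N x))\<^sup>2) \<longlonglongrightarrow> 0" by (rule tendsto_eventually)
    qed
  qed (use v2 in \<open>auto simp: r_def\<close>)
  then have "\<forall>\<^sub>F N in sequentially. (\<integral>x. (cmod (r N x))\<^sup>2 \<partial>lborel) < 2 * d * (e / 3)"
    using d e by (intro order_tendstoD) auto
  then obtain N where N: "(\<integral>x. (cmod (r N x))\<^sup>2 \<partial>lborel) < 2 * d * (e / 3)"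
    by (auto simp: eventually_sequentially)
  have N': "(\<integral>x. (cmod (r N x))\<^sup>2 \<partial>lborel) / (2 * d) < e / 3"
    using N d by (simp add: field_simps)
  have bound: "cmod (autocorr v t - autocorr v 0) \<le>
      N * (\<integral>x. norm (v (x - t) - v x) \<partial>lborel) + ((\<integral>x. (cmod (r N x))\<^sup>2 \<partial>lborel) / (2 * d) + 2 * d * V)" for t
  proof -
    have "autocorr v t - autocorr v 0 = (\<integral>x. v x * cnj (v (x - t) - v x) \<partial>lborel)"
      unfolding autocorr_def using autocorr_integrand[of t] autocorr_integrand[of 0]
      by (simp add: algebra_simps)
    also have "cmod \<dots> \<le> (\<integral>x. cmod (v x * cnj (v (x - t) - v x)) \<partial>lborel)"
      by (rule integral_norm_bound)
    also have "\<dots> \<le> (\<integral>x. N * norm (v (x - t) - v x) + ((cmod (r N x))\<^sup>2 / (2 * d) +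
        d * ((cmod (v (x - t)))\<^sup>2 + (cmod (v x))\<^sup>2)) \<partial>lborel)"
    proof (rule integral_mono)
      show "integrable lborel (\<lambda>x. cmod (v x * cnj (v (x - t) - v x)))"
        using autocorr_integrand[of t] autocorr_integrand[of 0] by (simp add: algebra_simps)
      show "integrable lborel (\<lambda>x. N * norm (v (x - t) - v x) + ((cmod (r N x))\<^sup>2 / (2 * d) +
        d * ((cmod (v (x - t)))\<^sup>2 + (cmod (v x))\<^sup>2)))"
        using v v2 integrable_translate_arg[of t] r2 by auto
      fix x
      let ?w = "v (x - t) - v x"
      show "cmod (v x * cnj ?w) \<le> N * norm ?w + ((cmod (r N x))\<^sup>2 / (2 * d) +
        d * ((cmod (v (x - t)))\<^sup>2 + (cmod (v x))\<^sup>2))"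
      proof (cases "cmod (v x) \<le> real N")
        case True
        then have "cmod (v x * cnj ?w) \<le> N * norm ?w" by (simp add: norm_mult mult_right_mono del: complex_cnj_diff)
        moreover have "0 \<le> (cmod (r N x))\<^sup>2 / (2 * d) + d * ((cmod (v (x - t)))\<^sup>2 + (cmod (v x))\<^sup>2)"
          using d by (intro add_nonneg_nonneg mult_nonneg_nonneg divide_nonneg_pos) auto
        ultimately show ?thesis by linarith
      next
        case False
        then have rv: "r N x = v x" by (simp add: r_def)
        have w: "(cmod ?w)\<^sup>2 \<le> 2 * ((cmod (v (x - t)))\<^sup>2 + (cmod (v x))\<^sup>2)"
        proof -
          have "(cmod ?w)\<^sup>2 \<le> (cmod (v (x - t)) + cmod (v x))\<^sup>2"
            by (intro power_mono norm_triangle_ineq4) auto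
          also have "\<dots> \<le> 2 * ((cmod (v (x - t)))\<^sup>2 + (cmod (v x))\<^sup>2)"
            using sum_squares_bound[of "cmod (v (x - t))" "cmod (v x)"] by (simp add: power2_sum)
          finally show ?thesis .
        qed
        have "0 \<le> (cmod (v x) - d * cmod ?w)\<^sup>2" by simp
        then have "2 * d * (cmod (v x) * cmod ?w) \<le> (cmod (v x))\<^sup>2 + d\<^sup>2 * (cmod ?w)\<^sup>2"
          by (simp add: power2_diff power_mult_distrib mult_ac)
        then have "cmod (v x) * cmod ?w \<le> ((cmod (v x))\<^sup>2 + d\<^sup>2 * (cmod ?w)\<^sup>2) / (2 * d)"
          using d by (simp add: field_simps)
        also have "\<dots> = (cmod (v x))\<^sup>2 / (2 * d) + d * ((cmod ?w)\<^sup>2 / 2)"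
          using d by (simp add: field_simps power2_eq_square)
        also have "\<dots> \<le> (cmod (v x))\<^sup>2 / (2 * d) + d * ((cmod (v (x - t)))\<^sup>2 + (cmod (v x))\<^sup>2)"
          using d w by (intro add_left_mono mult_left_mono) auto
        finally have "cmod (v x * cnj ?w) \<le> (cmod (v x))\<^sup>2 / (2 * d) + d * ((cmod (v (x - t)))\<^sup>2 + (cmod (v x))\<^sup>2)"
          by (simp add: norm_mult del: complex_cnj_diff)
        moreover have "0 \<le> N * norm ?w" by simp
        ultimately show ?thesis unfolding rv by linarith
      qed
    qed
    also have "\<dots> = N * (\<integral>x. norm (v (x - t) - v x) \<partial>lborel) + ((\<integral>x. (cmod (r N x))\<^sup>2 \<partial>lborel) / (2 * d) + d * (V + V))"
      using v v2 integrable_translate_arg[of t] r2[of N] integral_translate_arg[of t] by (simp add: V_def)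
    finally show ?thesis by simp
  qed
  have "(\<lambda>k. real N * (\<integral>x. norm (v (x - s k) - v x) \<partial>lborel)) \<longlonglongrightarrow> 0"
    using tendsto_mult_left[OF translation_L1[OF v, of "\<lambda>k. - s k"], of "real N"] tendsto_minus[OF s] by simp
  then have "\<forall>\<^sub>F k in sequentially. N * (\<integral>x. norm (v (x - s k) - v x) \<partial>lborel) < e / 3"
    using e by (intro order_tendstoD) auto
  then obtain K where K: "\<And>k. k \<ge> K \<Longrightarrow> N * (\<integral>x. norm (v (x - s k) - v x) \<partial>lborel) < e / 3"
    by (auto simp: eventually_sequentially)
  show "\<exists>K. \<forall>k\<ge>K. norm (autocorr v (s k) - autocorr v 0) < e"
  proof (intro exI allI impI)
    fix k assume "k \<ge> K"
    then show "norm (autocorr v (s k) - autocorr v 0) < e"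
      using bound[of "s k"] K[of k] N' d(2) by linarith
  qed
qed

text \<open>
  Both claims are Fubini's theorem for \<open>v(x) cnj(v(x - s))\<close>: the substitution \<open>y = x - s\<close> separates the
  variables.
\<close>

lemma
  shows autocorr_integrable: "integrable lborel (autocorr v)"
    and FT_autocorr: "FT (autocorr v) \<xi> = of_real ((cmod (FT v \<xi>))\<^sup>2)"
proof -
  have int: "integrable (lborel \<Otimes>\<^sub>M lborel) (\<lambda>(x, s). v x * cnj (v (x - s)))"
  proof (rule lborel_pair.Fubini_integrable)
    have "(\<integral>s. norm (v x * cnj (v (x - s))) \<partial>lborel) = norm (v x) * (\<integral>y. norm (v y) \<partial>lborel)" for x
      using lborel_integral_reflect[of "\<lambda>y. norm (v y)" x] by (simp add: norm_mult)
    then show "integrable lborel (\<lambda>x. \<integral>s. norm (case (x, s) of (x, s) \<Rightarrow> v x * cnj (v (x - s))) \<partial>lborel)"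
      using v by simp
    show "AE x in lborel. integrable lborel (\<lambda>s. case (x, s) of (x, s) \<Rightarrow> v x * cnj (v (x - s)))"
      using lborel_integrable_reflect[OF v] by auto
  qed measurable
  show "integrable lborel (autocorr v)"
    unfolding autocorr_def[abs_def] by (rule lborel_pair.integrable_snd[OF int])
  have int': "integrable (lborel \<Otimes>\<^sub>M lborel)
      (\<lambda>(x, s). v x * cnj (v (x - s)) * exp (- \<i> * complex_of_real (s \<bullet> \<xi>)))"
    using integrable_mult_cis(1)[OF int, of "\<lambda>(x, s). s \<bullet> \<xi>"] by (simp add: case_prod_unfold)
  have inner: "(\<integral>s. v x * cnj (v (x - s)) * exp (- \<i> * complex_of_real (s \<bullet> \<xi>)) \<partial>lborel)
      = v x * exp (- \<i> * complex_of_real (x \<bullet> \<xi>)) * cnj (FT v \<xi>)" for x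
  proof -
    have "(\<integral>s. v x * cnj (v (x - s)) * exp (- \<i> * complex_of_real (s \<bullet> \<xi>)) \<partial>lborel)
      = (\<integral>s. v x * exp (- \<i> * complex_of_real (x \<bullet> \<xi>)) *
          (cnj (v (x - s)) * exp (\<i> * complex_of_real ((x - s) \<bullet> \<xi>))) \<partial>lborel)"
    proof (rule Bochner_Integration.integral_cong[OF refl])
      fix s
      have "exp (- \<i> * complex_of_real (s \<bullet> \<xi>)) =
          exp (- \<i> * complex_of_real (x \<bullet> \<xi>)) * exp (\<i> * complex_of_real ((x - s) \<bullet> \<xi>))"
        by (simp add: exp_add[symmetric] inner_diff_left algebra_simps)
      then show "v x * cnj (v (x - s)) * exp (- \<i> * complex_of_real (s \<bullet> \<xi>)) =
        v x * exp (- \<i> * complex_of_real (x \<bullet> \<xi>)) *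
          (cnj (v (x - s)) * exp (\<i> * complex_of_real ((x - s) \<bullet> \<xi>)))" by simp
    qed
    also have "\<dots> = v x * exp (- \<i> * complex_of_real (x \<bullet> \<xi>)) *
        (\<integral>s. cnj (v (x - s)) * exp (\<i> * complex_of_real ((x - s) \<bullet> \<xi>)) \<partial>lborel)"
      by (rule integral_mult_right_zero)
    also have "(\<integral>s. cnj (v (x - s)) * exp (\<i> * complex_of_real ((x - s) \<bullet> \<xi>)) \<partial>lborel)
        = (\<integral>y. cnj (v y) * exp (\<i> * complex_of_real (y \<bullet> \<xi>)) \<partial>lborel)"
      by (rule lborel_integral_reflect[of "\<lambda>y. cnj (v y) * exp (\<i> * complex_of_real (y \<bullet> \<xi>))"]) measurable
    also have "\<dots> = cnj (FT v \<xi>)"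
      unfolding FT_def by (subst Bochner_Integration.integral_cnj[symmetric]) (simp add: exp_cnj)
    finally show ?thesis .
  qed
  have "FT (autocorr v) \<xi> = (\<integral>s. (\<integral>x. v x * cnj (v (x - s)) * exp (- \<i> * complex_of_real (s \<bullet> \<xi>)) \<partial>lborel) \<partial>lborel)"
    unfolding FT_def autocorr_def by simp
  also have "\<dots> = (\<integral>x. (\<integral>s. v x * cnj (v (x - s)) * exp (- \<i> * complex_of_real (s \<bullet> \<xi>)) \<partial>lborel) \<partial>lborel)"
    by (rule lborel_pair.Fubini_integral[OF int'])
  also have "\<dots> = FT v \<xi> * cnj (FT v \<xi>)"
    unfolding inner by (simp add: FT_def)
  also have "\<dots> = of_real ((cmod (FT v \<xi>))\<^sup>2)" by (metis complex_norm_square)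
  finally show "FT (autocorr v) \<xi> = of_real ((cmod (FT v \<xi>))\<^sup>2)" .
qed

lemma FT_bound: "cmod (FT v \<xi>) \<le> (\<integral>x. cmod (v x) \<partial>lborel)"
proof -
  have "cmod (FT v \<xi>) \<le> (\<integral>x. cmod (v x * exp (- \<i> * complex_of_real (x \<bullet> \<xi>))) \<partial>lborel)"
    unfolding FT_def by (rule integral_norm_bound)
  then show ?thesis by (simp add: norm_mult)
qed

lemma integrable_gauss_scaled: "c \<noteq> 0 \<Longrightarrow> integrable lborel (\<lambda>x. gauss (c *\<^sub>R x :: 'a))"
  using lborel_integrable_scaleR[OF _ integrable_gauss, of c 0] by simp

text \<open>
  The multiplication formula for the autocorrelation and a dilated Gaussian, whose transform is again
  a Gaussian, dilated the other way; the substitution \<open>s = e t\<close> removes the dilation from it.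
\<close>

lemma gauss_regularised:
  assumes e: "e > 0"
  shows "of_real (\<integral>\<xi>. (cmod (FT v \<xi>))\<^sup>2 * gauss (e *\<^sub>R \<xi>) \<partial>lborel)
    = of_real (sqrt (2 * pi) ^ DIM('a)) * (\<integral>t. autocorr v (e *\<^sub>R t) * of_real (gauss t) \<partial>lborel)"
proof -
  note [measurable] = borel_measurable_integrable[OF autocorr_integrable, simplified]
  \<comment> \<open>Evaluated at e t, the form in which it is met after the substitution s = e t.\<close>
  have FTg: "FT (\<lambda>\<xi>. complex_of_real (gauss (e *\<^sub>R \<xi>))) (e *\<^sub>R t) =
      of_real (inverse (e ^ DIM('a)) * (sqrt (2 * pi) ^ DIM('a) * gauss t))" for t :: 'a
  proof -
    have "FT (\<lambda>\<xi>. complex_of_real (gauss \<xi>)) t =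
        of_real (e ^ DIM('a)) * FT (\<lambda>\<xi>. complex_of_real (gauss (e *\<^sub>R \<xi>))) (e *\<^sub>R t)"
      unfolding FT_def using lborel_integral_scaleR[of e "\<lambda>x. complex_of_real (gauss x) * exp (- \<i> * complex_of_real (x \<bullet> t))" 0] e
      by (simp add: scaleR_conv_of_real)
    then show ?thesis unfolding FT_gauss using e by (simp add: field_simps)
  qed
  have "of_real (\<integral>\<xi>. (cmod (FT v \<xi>))\<^sup>2 * gauss (e *\<^sub>R \<xi>) \<partial>lborel) =
     (\<integral>\<xi>. FT (autocorr v) \<xi> * of_real (gauss (e *\<^sub>R \<xi>)) \<partial>lborel)"
    unfolding FT_autocorr by (simp flip: of_real_mult of_real_power)
  also have "\<dots> = (\<integral>s. autocorr v s * FT (\<lambda>\<xi>. complex_of_real (gauss (e *\<^sub>R \<xi>))) s \<partial>lborel)"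
    using e integrable_gauss_scaled[of e] by (intro FT_multiplication autocorr_integrable) auto
  also have "\<dots> = e ^ DIM('a) *\<^sub>R (\<integral>t. autocorr v (e *\<^sub>R t) * FT (\<lambda>\<xi>. complex_of_real (gauss (e *\<^sub>R \<xi>))) (e *\<^sub>R t) \<partial>lborel)"
    using lborel_integral_scaleR[of e "\<lambda>s. autocorr v s * FT (\<lambda>\<xi>. complex_of_real (gauss (e *\<^sub>R \<xi>))) s" 0] e by simp
  also have "\<dots> = (\<integral>t. of_real (sqrt (2 * pi) ^ DIM('a)) * (autocorr v (e *\<^sub>R t) * of_real (gauss t)) \<partial>lborel)"
    unfolding FTg using e
    by (subst integral_scaleR_right[symmetric]) (simp add: scaleR_conv_of_real field_simps)
  finally show ?thesis by simp
qed

text \<open>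
  Let the width \<open>1/e\<close> of the Gaussian tend to infinity. On the left of \<open>gauss_regularised\<close> the Gaussians
  increase to \<open>1\<close>, which gives integrability as well as the value. On the right the autocorrelation is
  bounded and continuous at \<open>0\<close>. The integral of the Gaussian supplies a second factor \<open>(2\<pi>)\<^bsup>d/2\<^esup>\<close>.
\<close>

lemma
  shows plancherel_integrable: "integrable lborel (\<lambda>\<xi>. (cmod (FT v \<xi>))\<^sup>2)"
    and plancherel: "(\<integral>\<xi>. (cmod (FT v \<xi>))\<^sup>2 \<partial>lborel) = (2 * pi) ^ DIM('a) * (\<integral>x. (cmod (v x))\<^sup>2 \<partial>lborel)"
proof -
  note [measurable] = borel_measurable_integrable[OF autocorr_integrable, simplified]
  define V where "V = (\<integral>x. (cmod (v x))\<^sup>2 \<partial>lborel)"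
  define e where "e k = inverse (real (Suc k))" for k
  have e: "e k > 0" for k by (simp add: e_def)
  have e0: "e \<longlonglongrightarrow> 0" unfolding e_def by (rule LIMSEQ_inverse_real_of_nat)
  define f where "f k \<xi> = (cmod (FT v \<xi>))\<^sup>2 * gauss (e k *\<^sub>R \<xi>)" for k \<xi>
  have f_reg: "of_real (integral\<^sup>L lborel (f k)) =
      of_real (sqrt (2 * pi) ^ DIM('a)) * (\<integral>t. autocorr v (e k *\<^sub>R t) * of_real (gauss t) \<partial>lborel)" for k
    using gauss_regularised[OF e, of k] by (simp add: f_def[abs_def])
  have "(\<lambda>k. \<integral>t. autocorr v (e k *\<^sub>R t) * of_real (gauss t) \<partial>lborel) \<longlonglongrightarrow> (\<integral>t. autocorr v 0 * of_real (gauss (t :: 'a)) \<partial>lborel)"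
  proof (rule integral_dominated_convergence[where w="\<lambda>t. V * gauss t"])
    show "AE t :: 'a in lborel. (\<lambda>k. autocorr v (e k *\<^sub>R t) * of_real (gauss t)) \<longlonglongrightarrow> autocorr v 0 * of_real (gauss t)"
      using tendsto_scaleR[OF e0 tendsto_const] by (intro AE_I2 tendsto_intros autocorr_continuous) simp
    show "AE t in lborel. norm (autocorr v (e k *\<^sub>R t) * of_real (gauss t)) \<le> V * gauss t" for k
      using autocorr_bound by (auto simp: norm_mult V_def gauss_pos less_imp_le intro!: mult_right_mono)
  qed (simp_all add: integrable_gauss)
  then have "(\<lambda>k. of_real (integral\<^sup>L lborel (f k)) :: complex) \<longlonglongrightarrow>
      of_real (sqrt (2 * pi) ^ DIM('a)) * (\<integral>t. autocorr v 0 * of_real (gauss (t :: 'a)) \<partial>lborel)"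
    unfolding f_reg by (rule tendsto_mult_left)
  moreover have "of_real (sqrt (2 * pi) ^ DIM('a)) * (\<integral>t. autocorr v 0 * of_real (gauss (t :: 'a)) \<partial>lborel)
      = of_real ((2 * pi) ^ DIM('a) * V)"
  proof -
    have "sqrt (2 * pi) ^ DIM('a) * sqrt (2 * pi) ^ DIM('a) = (2 * pi) ^ DIM('a)"
      by (subst power_mult_distrib[symmetric]) simp
    then have "complex_of_real (sqrt (2 * pi) ^ DIM('a)) * (of_real V * of_real (sqrt (2 * pi) ^ DIM('a)))
      = of_real ((2 * pi) ^ DIM('a) * V)"
      unfolding of_real_mult[symmetric] of_real_eq_iff by (simp only: mult_ac)
    then show ?thesis by (simp only: integral_mult_right_zero integral_complex_of_real integral_gauss autocorr_0 V_def)
  qed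
  ultimately have lim: "(\<lambda>k. integral\<^sup>L lborel (f k)) \<longlonglongrightarrow> (2 * pi) ^ DIM('a) * V"
    by (simp only: tendsto_of_real_iff)
  have 1: "integrable lborel (f k)" for k
  proof (rule Bochner_Integration.integrable_bound)
    show "integrable lborel (\<lambda>\<xi>. (\<integral>x. cmod (v x) \<partial>lborel)\<^sup>2 * gauss (e k *\<^sub>R \<xi> :: 'a))"
      using integrable_gauss_scaled[of "e k"] e[of k] by simp
    show "AE x in lborel. norm (f k x) \<le> norm ((\<integral>x. cmod (v x) \<partial>lborel)\<^sup>2 * gauss (e k *\<^sub>R x))"
      using FT_bound by (auto simp: f_def abs_mult gauss_pos less_imp_le intro!: mult_right_mono power_mono)
  qed (simp add: f_def[abs_def])
  have 2: "AE \<xi> in lborel. mono (\<lambda>k. f k \<xi>)"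
  proof (rule AE_I2)
    fix \<xi> show "mono (\<lambda>k. f k \<xi>)"
    proof (rule monoI)
      fix i j :: nat assume "i \<le> j"
      then have "e j \<le> e i" by (simp add: e_def field_simps)
      then have "norm (e j *\<^sub>R \<xi>) \<le> norm (e i *\<^sub>R \<xi>)" using e[of i] e[of j] by (auto intro!: mult_right_mono)
      then have "gauss (e i *\<^sub>R \<xi>) \<le> gauss (e j *\<^sub>R \<xi>)" unfolding gauss_def by (simp add: power_mono)
      then show "f i \<xi> \<le> f j \<xi>" unfolding f_def by (intro mult_left_mono) auto
    qed
  qed
  have 3: "AE \<xi> in lborel. (\<lambda>k. f k \<xi>) \<longlonglongrightarrow> (cmod (FT v \<xi>))\<^sup>2"
  proof (rule AE_I2)
    fix \<xi>
    have "(\<lambda>k. f k \<xi>) \<longlonglongrightarrow> (cmod (FT v \<xi>))\<^sup>2 * exp (- (norm (0 *\<^sub>R \<xi>))\<^sup>2 / 2)"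
      unfolding f_def gauss_def by (intro tendsto_intros e0) auto
    then show "(\<lambda>k. f k \<xi>) \<longlonglongrightarrow> (cmod (FT v \<xi>))\<^sup>2" by simp
  qed
  have 4: "(\<lambda>\<xi>. (cmod (FT v \<xi>))\<^sup>2) \<in> borel_measurable lborel" by simp
  show "integrable lborel (\<lambda>\<xi>. (cmod (FT v \<xi>))\<^sup>2)"
    by (rule integrable_monotone_convergence[OF 1 2 3 lim 4])
  show "(\<integral>\<xi>. (cmod (FT v \<xi>))\<^sup>2 \<partial>lborel) = (2 * pi) ^ DIM('a) * (\<integral>x. (cmod (v x))\<^sup>2 \<partial>lborel)"
    using integral_monotone_convergence[OF 1 2 3 lim 4] by (simp add: V_def)
qed

end

section \<open>The space \<open>L\<^sup>2\<close>\<close>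

lemma L2_measurable: "f \<in> L2 \<Longrightarrow> f \<in> borel_measurable borel"
  by (simp add: L2_def)

lemma L2_integrable: "f \<in> L2 \<Longrightarrow> integrable lborel (\<lambda>x. (cmod (f x))\<^sup>2)"
  by (simp add: L2_def)

lemma L2I: "f \<in> borel_measurable borel \<Longrightarrow> integrable lborel (\<lambda>x. (cmod (f x))\<^sup>2) \<Longrightarrow> f \<in> L2"
  by (simp add: L2_def)

lemma L2_norm_nonneg [simp]: "0 \<le> L2_norm f"
  by (simp add: L2_norm_def)

lemma L2_norm_sq: "(L2_norm f)\<^sup>2 = (\<integral>x. (cmod (f x))\<^sup>2 \<partial>lborel)"
  by (simp add: L2_norm_def)

lemma L2_bounded:
  assumes [measurable]: "f \<in> borel_measurable borel" and g: "g \<in> L2" and le: "\<And>x. cmod (f x) \<le> cmod (g x)"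
  shows "f \<in> L2"
proof (rule L2I)
  show "integrable lborel (\<lambda>x. (cmod (f x))\<^sup>2)"
    using le by (intro Bochner_Integration.integrable_bound[OF L2_integrable[OF g]]) (auto intro!: power_mono AE_I2)
qed simp

lemma L2_scale:
  assumes "f \<in> L2"
  shows "(\<lambda>x. c * f x) \<in> L2"
  using L2_measurable[OF assms] L2_integrable[OF assms] by (intro L2I) (auto simp: norm_mult power_mult_distrib)

lemma L2_add:
  assumes f: "f \<in> L2" and g: "g \<in> L2"
  shows "(\<lambda>x. f x + g x) \<in> L2"
proof (rule L2I)
  note [measurable] = L2_measurable[OF f] L2_measurable[OF g]
  show "(\<lambda>x. f x + g x) \<in> borel_measurable borel" by measurable
  show "integrable lborel (\<lambda>x. (cmod (f x + g x))\<^sup>2)"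
  proof (rule Bochner_Integration.integrable_bound)
    show "integrable lborel (\<lambda>x. 2 * (cmod (f x))\<^sup>2 + 2 * (cmod (g x))\<^sup>2)"
      using f g by (simp add: L2_integrable)
    show "AE x in lborel. norm ((cmod (f x + g x))\<^sup>2) \<le> norm (2 * (cmod (f x))\<^sup>2 + 2 * (cmod (g x))\<^sup>2)"
    proof (rule AE_I2)
      fix x
      have "(cmod (f x + g x))\<^sup>2 \<le> (cmod (f x) + cmod (g x))\<^sup>2"
        by (intro power_mono norm_triangle_ineq) auto
      also have "\<dots> \<le> 2 * (cmod (f x))\<^sup>2 + 2 * (cmod (g x))\<^sup>2"
        using sum_squares_bound[of "cmod (f x)" "cmod (g x)"] by (simp add: power2_sum)
      finally show "norm ((cmod (f x + g x))\<^sup>2) \<le> norm (2 * (cmod (f x))\<^sup>2 + 2 * (cmod (g x))\<^sup>2)" by simp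
    qed
  qed simp
qed

lemma L2_diff:
  assumes f: "f \<in> L2" and g: "g \<in> L2"
  shows "(\<lambda>x. f x - g x) \<in> L2"
  using L2_add[OF f L2_scale[OF g, of "-1"]] by simp

lemma L2_mult_integrable:
  assumes "f \<in> L2" "g \<in> L2"
  shows "integrable lborel (\<lambda>x. f x * g x)" "integrable lborel (\<lambda>x. f x * cnj (g x))"
proof -
  note [measurable] = L2_measurable[OF assms(1)] L2_measurable[OF assms(2)]
  show "integrable lborel (\<lambda>x. f x * g x)" "integrable lborel (\<lambda>x. f x * cnj (g x))"
    by (rule integrable_mult_L2; use assms in \<open>simp add: L2_integrable\<close>)+
qed

lemma L2_Cauchy_Schwarz:
  assumes f: "f \<in> L2" and g: "g \<in> L2"
  shows "(\<integral>x. cmod (f x) * cmod (g x) \<partial>lborel) \<le> L2_norm f * L2_norm g"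
proof -
  note [measurable] = L2_measurable[OF f] L2_measurable[OF g]
  let ?I = "\<integral>x. cmod (f x) * cmod (g x) \<partial>lborel"
  have I: "integrable lborel (\<lambda>x. cmod (f x) * cmod (g x))"
    using integrable_norm[OF L2_mult_integrable(1)[OF f g]] by (simp add: norm_mult)
  have "(\<integral>\<^sup>+x. ennreal (cmod (f x)) * ennreal (cmod (g x)) \<partial>lborel)\<^sup>2
     \<le> (\<integral>\<^sup>+x. (ennreal (cmod (f x)))\<^sup>2 \<partial>lborel) * (\<integral>\<^sup>+x. (ennreal (cmod (g x)))\<^sup>2 \<partial>lborel)"
    by (rule Cauchy_Schwarz_nn_integral) measurable
  also have "(\<integral>\<^sup>+x. ennreal (cmod (f x)) * ennreal (cmod (g x)) \<partial>lborel) = ennreal ?I"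
    using nn_integral_eq_integral[OF I] by (simp add: ennreal_mult)
  also have "(\<integral>\<^sup>+x. (ennreal (cmod (f x)))\<^sup>2 \<partial>lborel) = ennreal ((L2_norm f)\<^sup>2)"
    using nn_integral_eq_integral[OF L2_integrable[OF f]] by (simp add: ennreal_power L2_norm_sq)
  also have "(\<integral>\<^sup>+x. (ennreal (cmod (g x)))\<^sup>2 \<partial>lborel) = ennreal ((L2_norm g)\<^sup>2)"
    using nn_integral_eq_integral[OF L2_integrable[OF g]] by (simp add: ennreal_power L2_norm_sq)
  finally have "?I\<^sup>2 \<le> (L2_norm f * L2_norm g)\<^sup>2"
    by (simp add: ennreal_power ennreal_mult[symmetric] power_mult_distrib)
  then show ?thesis by (rule power2_le_imp_le) simp
qed

lemma L2_norm_triangle: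
  assumes f: "f \<in> L2" and g: "g \<in> L2"
  shows "L2_norm (\<lambda>x. f x + g x) \<le> L2_norm f + L2_norm g"
proof -
  have I: "integrable lborel (\<lambda>x. cmod (f x) * cmod (g x))"
    using integrable_norm[OF L2_mult_integrable(1)[OF f g]] by (simp add: norm_mult)
  have "(L2_norm (\<lambda>x. f x + g x))\<^sup>2 \<le> (\<integral>x. (cmod (f x))\<^sup>2 + (cmod (g x))\<^sup>2 + 2 * (cmod (f x) * cmod (g x)) \<partial>lborel)"
    unfolding L2_norm_sq
  proof (rule integral_mono)
    show "integrable lborel (\<lambda>x. (cmod (f x + g x))\<^sup>2)" using f g by (intro L2_integrable L2_add)
    show "integrable lborel (\<lambda>x. (cmod (f x))\<^sup>2 + (cmod (g x))\<^sup>2 + 2 * (cmod (f x) * cmod (g x)))"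
      using f g I by (simp add: L2_integrable)
    show "(cmod (f x + g x))\<^sup>2 \<le> (cmod (f x))\<^sup>2 + (cmod (g x))\<^sup>2 + 2 * (cmod (f x) * cmod (g x))" for x
      using power_mono[OF norm_triangle_ineq[of "f x" "g x"], of 2] by (simp add: power2_sum)
  qed
  also have "\<dots> = (L2_norm f)\<^sup>2 + (L2_norm g)\<^sup>2 + 2 * (\<integral>x. cmod (f x) * cmod (g x) \<partial>lborel)"
    using f g I by (simp add: L2_integrable L2_norm_sq)
  also have "\<dots> \<le> (L2_norm f + L2_norm g)\<^sup>2"
    using L2_Cauchy_Schwarz[OF f g] by (simp add: power2_sum)
  finally show ?thesis by (rule power2_le_imp_le) simp
qed

lemma L2_norm_cmod_cong: "(\<And>x. cmod (f x) = cmod (g x)) \<Longrightarrow> L2_norm f = L2_norm g"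
  by (simp add: L2_norm_def)

lemma L2_norm_minus_commute: "L2_norm (\<lambda>x. f x - g x) = L2_norm (\<lambda>x. g x - f x)"
  by (rule L2_norm_cmod_cong) (rule norm_minus_commute)

lemma L2_norm_triangle_dist:
  assumes f: "f \<in> L2" and g: "g \<in> L2" and h: "h \<in> L2"
  shows "L2_norm (\<lambda>x. f x - h x) \<le> L2_norm (\<lambda>x. f x - g x) + L2_norm (\<lambda>x. g x - h x)"
  using L2_norm_triangle[OF L2_diff[OF f g] L2_diff[OF g h]] by simp

lemma L2_norm_eq_0_AE:
  assumes "f \<in> L2" "L2_norm f = 0"
  shows "AE x in lborel. f x = 0"
  using assms integral_nonneg_eq_0_iff_AE[OF L2_integrable[OF assms(1)]]
  by (simp add: L2_norm_def)

lemma L2_norm_AE_cong: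
  assumes "f \<in> L2" "g \<in> L2" "AE x in lborel. f x = g x"
  shows "L2_norm f = L2_norm g"
  unfolding L2_norm_def using assms
  by (intro arg_cong[where f=sqrt] integral_cong_AE) (auto dest: L2_measurable)

lemma L2_tendsto_add:
  assumes "L2_tendsto f u A" "L2_tendsto g v A"
  shows "L2_tendsto (\<lambda>i x. f i x + g i x) (\<lambda>x. u x + v x) A"
proof -
  have u: "u \<in> L2" and v: "v \<in> L2" and f: "\<forall>\<^sub>F i in A. f i \<in> L2" and g: "\<forall>\<^sub>F i in A. g i \<in> L2"
    using assms by (auto simp: L2_tendsto_def)
  have lim: "((\<lambda>i. L2_norm (\<lambda>x. f i x - u x) + L2_norm (\<lambda>x. g i x - v x)) \<longlongrightarrow> 0) A"
    using assms tendsto_add[of _ 0 A _ 0] by (auto simp: L2_tendsto_def)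
  have "\<forall>\<^sub>F i in A. L2_norm (\<lambda>x. (f i x + g i x) - (u x + v x)) \<le> L2_norm (\<lambda>x. f i x - u x) + L2_norm (\<lambda>x. g i x - v x)"
    using f g
  proof eventually_elim
    case (elim i)
    have "(\<lambda>x. (f i x + g i x) - (u x + v x)) = (\<lambda>x. (f i x - u x) + (g i x - v x))" by auto
    then show ?case using L2_norm_triangle[OF L2_diff[OF elim(1) u] L2_diff[OF elim(2) v]] by simp
  qed
  then have "((\<lambda>i. L2_norm (\<lambda>x. (f i x + g i x) - (u x + v x))) \<longlongrightarrow> 0) A"
    by (intro tendsto_sandwich[OF _ _ tendsto_const lim]) auto
  moreover have "\<forall>\<^sub>F i in A. (\<lambda>x. f i x + g i x) \<in> L2"
    using f g by eventually_elim (rule L2_add)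
  ultimately show ?thesis using u v by (simp add: L2_tendsto_def L2_add)
qed

lemma L2_tendsto_uminus:
  fixes u :: "real ^ 'd \<Rightarrow> complex"
  assumes "L2_tendsto f u A"
  shows "L2_tendsto (\<lambda>i x. - f i x) (\<lambda>x. - u x) A"
proof -
  have "L2_norm (\<lambda>x. - f i x - - u x) = L2_norm (\<lambda>x. f i x - u x)" for i
    by (rule L2_norm_cmod_cong) (metis minus_diff_minus norm_minus_cancel)
  moreover have "(\<lambda>x. - h x) \<in> L2" if "h \<in> L2" for h :: "real ^ 'd \<Rightarrow> complex"
    using L2_scale[OF that, of "-1"] by simp
  ultimately show ?thesis using assms unfolding L2_tendsto_def
    by (auto elim: eventually_mono)
qed

lemma L2_tendsto_diff:
  assumes "L2_tendsto f u A" "L2_tendsto g v A"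
  shows "L2_tendsto (\<lambda>i x. f i x - g i x) (\<lambda>x. u x - v x) A"
  using L2_tendsto_add[OF assms(1) L2_tendsto_uminus[OF assms(2)]] by simp

lemma L2_tendsto_const: "u \<in> L2 \<Longrightarrow> L2_tendsto (\<lambda>_. u) u A"
  by (simp add: L2_tendsto_def L2_norm_def)

lemma L2_tendsto_norm:
  assumes "L2_tendsto f u A"
  shows "((\<lambda>i. L2_norm (f i)) \<longlongrightarrow> L2_norm u) A"
proof -
  have u: "u \<in> L2" and f: "\<forall>\<^sub>F i in A. f i \<in> L2" using assms by (auto simp: L2_tendsto_def)
  have lim: "((\<lambda>i. L2_norm (\<lambda>x. f i x - u x)) \<longlongrightarrow> 0) A" using assms by (simp add: L2_tendsto_def)
  have "\<forall>\<^sub>F i in A. norm (L2_norm (f i) - L2_norm u) \<le> L2_norm (\<lambda>x. f i x - u x)"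
    using f
  proof eventually_elim
    case (elim i)
    have "L2_norm (f i) \<le> L2_norm (\<lambda>x. f i x - u x) + L2_norm u"
      using L2_norm_triangle[OF L2_diff[OF elim u] u] by simp
    moreover have "L2_norm u \<le> L2_norm (\<lambda>x. f i x - u x) + L2_norm (f i)"
      using L2_norm_triangle[OF L2_diff[OF u elim] elim] by (simp add: L2_norm_minus_commute)
    ultimately show ?case by (simp add: abs_if)
  qed
  from Lim_null_comparison[OF this lim] show ?thesis by (simp add: LIM_zero_iff)
qed

text \<open>
  Completeness, for sequences whose successive distances decay geometrically. Pointwise convergence
  is obtained from the series of the squared differences with weights \<open>2\<^sup>k\<close>: its integral is finite since
  the squared norms decay like \<open>4\<^sup>-\<^sup>k\<close>, and where it converges the differences decay like \<open>2\<^bsup>-k/2\<^esup>\<close>. Fatou's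
  lemma turns the pointwise limit into an \<open>L\<^sup>2\<close> limit.
\<close>

lemma L2_complete_fast:
  fixes g :: "nat \<Rightarrow> real ^ 'd \<Rightarrow> complex"
  assumes g: "\<And>k. g k \<in> L2" and fast: "\<And>k. L2_norm (\<lambda>x. g (Suc k) x - g k x) \<le> C * (1/2) ^ k"
  shows "\<exists>G. L2_tendsto g G sequentially"
proof -
  note [measurable] = L2_measurable[OF g]
  have C: "0 \<le> C" using order_trans[OF L2_norm_nonneg fast[of 0]] by simp
  have dist: "L2_norm (\<lambda>x. g (k + m) x - g k x) \<le> 2 * C * (1/2) ^ k" for k m
  proof -
    have "L2_norm (\<lambda>x. g (k + m) x - g k x) \<le> 2 * C * (1/2) ^ k * (1 - (1/2) ^ m)"
    proof (induction m)
      case (Suc m)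
      have "L2_norm (\<lambda>x. g (k + Suc m) x - g k x) \<le> C * (1/2) ^ (k + m) + 2 * C * (1/2) ^ k * (1 - (1/2) ^ m)"
        using L2_norm_triangle_dist[OF g[of "k + Suc m"] g[of "k + m"] g[of k]] fast[of "k + m"] Suc by simp
      also have "\<dots> = 2 * C * (1/2) ^ k * (1 - (1/2) ^ Suc m)"
        by (simp add: power_add algebra_simps)
      finally show ?case .
    qed (simp add: L2_norm_def)
    also have "\<dots> \<le> 2 * C * (1/2) ^ k * 1"
      using C by (intro mult_left_mono) auto
    finally show ?thesis by simp
  qed
  \<comment> \<open>The weight 2 ^ k is small enough for the integrals of D k to be summable and large enough for
    boundedness of D k x in k to force geometric decay of the differences at x.\<close>
  define D where "D k x = 2 ^ k * (cmod (g (Suc k) x - g k x))\<^sup>2" for k x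
  have Dm[measurable]: "D k \<in> borel_measurable borel" for k unfolding D_def by measurable
  have Dn: "0 \<le> D k x" for k x by (simp add: D_def)
  have "(\<integral>\<^sup>+x. (\<Sum>k. ennreal (D k x)) \<partial>lborel) = (\<Sum>k. \<integral>\<^sup>+x. ennreal (D k x) \<partial>lborel)"
    by (rule nn_integral_suminf) measurable
  also have "\<dots> \<le> (\<Sum>k. ennreal (C\<^sup>2 * (1/2) ^ k))"
  proof (rule suminf_le)
    fix k
    have "(\<integral>\<^sup>+x. ennreal (D k x) \<partial>lborel) = ennreal (\<integral>x. D k x \<partial>lborel)"
      using L2_integrable[OF L2_diff[OF g g]] Dn by (intro nn_integral_eq_integral) (auto simp: D_def)
    also have "(\<integral>x. D k x \<partial>lborel) = 2 ^ k * (L2_norm (\<lambda>x. g (Suc k) x - g k x))\<^sup>2"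
      by (simp add: D_def L2_norm_sq)
    also have "\<dots> \<le> 2 ^ k * (C * (1/2) ^ k)\<^sup>2"
      using fast[of k] by (intro mult_left_mono power_mono) auto
    also have "\<dots> = C\<^sup>2 * (1/2) ^ k"
      by (simp add: power_mult_distrib power2_eq_square power_divide)
    finally show "(\<integral>\<^sup>+x. ennreal (D k x) \<partial>lborel) \<le> ennreal (C\<^sup>2 * (1/2) ^ k)"
      by (simp add: ennreal_leI)
  qed auto
  also have "\<dots> < \<infinity>"
    using C by (subst suminf_ennreal2) (auto intro!: summable_mult summable_geometric)
  finally have "AE x in lborel. (\<Sum>k. ennreal (D k x)) \<noteq> \<infinity>"
    by (intro nn_integral_PInf_AE) (auto simp: less_top)
  then have conv: "AE x in lborel. convergent (\<lambda>k. g k x)"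
  proof eventually_elim
    case (elim x)
    have sD: "summable (\<lambda>k. D k x)"
      using elim Dn by (intro summable_suminf_not_top) auto
    define M where "M = (\<Sum>k. D k x)"
    have M: "D k x \<le> M" for k
      using sum_le_suminf[OF sD, of "{k}"] Dn by (simp add: M_def)
    have le: "norm (g (Suc k) x - g k x) \<le> sqrt M * (1 / sqrt 2) ^ k" for k
    proof -
      have "(cmod (g (Suc k) x - g k x))\<^sup>2 \<le> M / 2 ^ k"
        using M[of k] by (simp add: D_def field_simps)
      then have "sqrt ((cmod (g (Suc k) x - g k x))\<^sup>2) \<le> sqrt (M / 2 ^ k)"
        by (rule real_sqrt_le_mono)
      then show ?thesis by (simp add: real_sqrt_divide real_sqrt_power power_divide)
    qed
    have "summable (\<lambda>k. g (Suc k) x - g k x)"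
    proof (rule summable_comparison_test)
      show "\<exists>N. \<forall>n\<ge>N. norm (g (Suc n) x - g n x) \<le> sqrt M * (1 / sqrt 2) ^ n" using le by blast
      show "summable (\<lambda>k. sqrt M * (1 / sqrt 2) ^ k)"
        by (intro summable_mult summable_geometric) auto
    qed
    then have "convergent (\<lambda>n. \<Sum>k<n. g (Suc k) x - g k x)"
      by (simp add: summable_iff_convergent)
    then have "convergent (\<lambda>n. g n x - g 0 x)"
      by (simp only: sum_lessThan_telescope[of "\<lambda>k. g k x"])
    then show "convergent (\<lambda>k. g k x)"
      using convergent_add[OF _ convergent_const, of "\<lambda>n. g n x - g 0 x" "g 0 x"] by simp
  qed
  define G where "G x = lim (\<lambda>k. g k x)" for x
  have Gm[measurable]: "G \<in> borel_measurable borel"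
    unfolding G_def by (rule borel_measurable_lim_metric) measurable
  have lim: "AE x in lborel. (\<lambda>k. g k x) \<longlonglongrightarrow> G x"
    using conv by eventually_elim (simp add: G_def convergent_LIMSEQ_iff)
  have fatou: "(\<integral>\<^sup>+x. ennreal ((cmod (G x - g k x))\<^sup>2) \<partial>lborel) \<le> ennreal ((2 * C * (1/2) ^ k)\<^sup>2)" for k
  proof -
    have "(\<integral>\<^sup>+x. ennreal ((cmod (G x - g k x))\<^sup>2) \<partial>lborel)
        = (\<integral>\<^sup>+x. liminf (\<lambda>j. ennreal ((cmod (g j x - g k x))\<^sup>2)) \<partial>lborel)"
    proof (rule nn_integral_cong_AE, use lim in eventually_elim)
      case (elim x)
      have "(\<lambda>j. ennreal ((cmod (g j x - g k x))\<^sup>2)) \<longlonglongrightarrow> ennreal ((cmod (G x - g k x))\<^sup>2)"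
        by (intro tendsto_intros elim)
      then show ?case by (metis lim_imp_Liminf sequentially_bot)
    qed
    also have "\<dots> \<le> liminf (\<lambda>j. \<integral>\<^sup>+x. ennreal ((cmod (g j x - g k x))\<^sup>2) \<partial>lborel)"
      by (rule nn_integral_liminf) measurable
    also have "\<dots> \<le> ennreal ((2 * C * (1/2) ^ k)\<^sup>2)"
    proof (rule Liminf_le)
      show "\<forall>\<^sub>F j in sequentially. (\<integral>\<^sup>+x. ennreal ((cmod (g j x - g k x))\<^sup>2) \<partial>lborel) \<le> ennreal ((2 * C * (1/2) ^ k)\<^sup>2)"
        using eventually_ge_at_top[of k]
      proof eventually_elim
        case (elim j)
        have "(\<integral>\<^sup>+x. ennreal ((cmod (g j x - g k x))\<^sup>2) \<partial>lborel) = ennreal ((L2_norm (\<lambda>x. g j x - g k x))\<^sup>2)"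
          unfolding L2_norm_sq by (rule nn_integral_eq_integral[OF L2_integrable[OF L2_diff[OF g g]]]) simp
        also have "\<dots> \<le> ennreal ((2 * C * (1/2) ^ k)\<^sup>2)"
          using dist[of k "j - k"] elim by (intro ennreal_leI power_mono) auto
        finally show ?case .
      qed
    qed simp
    finally show ?thesis .
  qed
  have diff: "(\<lambda>x. G x - g k x) \<in> L2" for k
  proof (rule L2I)
    show "integrable lborel (\<lambda>x. (cmod (G x - g k x))\<^sup>2)"
      using fatou[of k] by (intro integrableI_bounded) (auto intro: le_less_trans)
  qed simp
  have G: "G \<in> L2" using L2_add[OF diff[of 0] g[of 0]] by simp
  have norm: "L2_norm (\<lambda>x. g k x - G x) \<le> 2 * C * (1/2) ^ k" for k
  proof (rule power2_le_imp_le)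
    have "ennreal ((L2_norm (\<lambda>x. g k x - G x))\<^sup>2) \<le> ennreal ((2 * C * (1/2) ^ k)\<^sup>2)"
      using fatou[of k] unfolding L2_norm_minus_commute[of "g k"] L2_norm_sq
      by (subst nn_integral_eq_integral[symmetric]) (auto intro!: L2_integrable diff)
    then show "(L2_norm (\<lambda>x. g k x - G x))\<^sup>2 \<le> (2 * C * (1/2) ^ k)\<^sup>2"
      by (subst (asm) ennreal_le_iff) auto
  qed (use C in auto)
  have "(\<lambda>k. L2_norm (\<lambda>x. g k x - G x)) \<longlonglongrightarrow> 0"
  proof (rule tendsto_sandwich[OF _ _ tendsto_const])
    have "(\<lambda>k. 2 * C * (1/2) ^ k) \<longlonglongrightarrow> 2 * C * 0"
      by (intro tendsto_mult_left LIMSEQ_power_zero) simp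
    then show "(\<lambda>k. 2 * C * (1/2) ^ k) \<longlonglongrightarrow> 0" by simp
  qed (use norm in auto)
  then show ?thesis using G g by (auto simp: L2_tendsto_def)
qed

section \<open>The Fourier transform on \<open>L\<^sup>2\<close>\<close>

lemma fourier_eq_FT: "fourier v = (\<lambda>\<xi>. of_real (1 / (2 * pi) ^ CARD('d)) * FT v \<xi>)"
  for v :: "real ^ 'd \<Rightarrow> complex"
  by (rule ext) (simp add: fourier_def FT_def scaleR_conv_of_real)

context
  fixes v :: "real ^ 'd \<Rightarrow> complex"
  assumes v: "integrable lborel v" and v2: "v \<in> L2"
begin

lemma FT_L2: "FT v \<in> L2"
  using plancherel_integrable[OF v L2_integrable[OF v2]] FT_measurable[OF L2_measurable[OF v2]]
  by (intro L2I) auto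

lemma L2_norm_FT: "(L2_norm (FT v))\<^sup>2 = (2 * pi) ^ CARD('d) * (L2_norm v)\<^sup>2"
  using plancherel[OF v L2_integrable[OF v2]] by (simp add: L2_norm_sq)

lemma fourier_L2_mem: "fourier v \<in> L2"
  unfolding fourier_eq_FT by (rule L2_scale[OF FT_L2])

lemma L2_norm_fourier: "L2_norm v = sqrt ((2 * pi) ^ CARD('d)) * L2_norm (fourier v)"
proof -
  let ?c = "(2 * pi) ^ CARD('d)"
  have "(L2_norm (fourier v))\<^sup>2 = (1 / ?c)\<^sup>2 * (L2_norm (FT v))\<^sup>2"
    unfolding L2_norm_sq fourier_eq_FT by (simp add: norm_mult power_mult_distrib norm_divide norm_power power_divide)
  also have "\<dots> = (L2_norm v)\<^sup>2 / ?c"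
    unfolding L2_norm_FT by (simp add: power2_eq_square)
  finally have "(L2_norm v)\<^sup>2 = (sqrt ?c * L2_norm (fourier v))\<^sup>2"
    by (simp add: power_mult_distrib)
  then show ?thesis by (subst (asm) power2_eq_iff_nonneg) auto
qed

end

lemma fourier_add:
  assumes "integrable lborel v" "integrable lborel w"
  shows "fourier (\<lambda>x. v x + w x) = (\<lambda>\<xi>. fourier v \<xi> + fourier w \<xi>)"
proof
  fix \<xi>
  have "integrable lborel (\<lambda>x. v x * exp (- \<i> * complex_of_real (x \<bullet> \<xi>)))"
    "integrable lborel (\<lambda>x. w x * exp (- \<i> * complex_of_real (x \<bullet> \<xi>)))"
    by (rule integrable_mult_cis(1); use assms in simp)+
  then show "fourier (\<lambda>x. v x + w x) \<xi> = fourier v \<xi> + fourier w \<xi>"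
    by (simp add: fourier_def distrib_right scaleR_add_right)
qed

lemma fourier_uminus: "fourier (\<lambda>x. - v x) = (\<lambda>\<xi>. - fourier v \<xi>)"
  by (rule ext) (simp add: fourier_def)

lemma fourier_diff:
  assumes "integrable lborel v" "integrable lborel w"
  shows "fourier (\<lambda>x. v x - w x) = (\<lambda>\<xi>. fourier v \<xi> - fourier w \<xi>)"
  using fourier_add[of v "\<lambda>x. - w x"] assms by (simp add: fourier_uminus)

text \<open>
  With the normalisation of \<^const>\<open>fourier\<close> the inverse transform carries no constant.
\<close>

definition IFT :: "(real ^ 'd \<Rightarrow> complex) \<Rightarrow> real ^ 'd \<Rightarrow> complex" where
  "IFT h x = FT h (- x)"

lemma IFT_eq: "IFT h x = (\<integral>\<xi>. exp (\<i> * complex_of_real (x \<bullet> \<xi>)) * h \<xi> \<partial>lborel)"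
  by (simp add: IFT_def FT_def inner_commute mult.commute)

lemma L2_norm_diff_sq:
  assumes f: "f \<in> L2" and g: "g \<in> L2"
  shows "(L2_norm (\<lambda>x. f x - g x))\<^sup>2 = (L2_norm f)\<^sup>2 + (L2_norm g)\<^sup>2 - 2 * Re (\<integral>x. f x * cnj (g x) \<partial>lborel)"
proof -
  have I: "integrable lborel (\<lambda>x. f x * cnj (g x))" by (rule L2_mult_integrable(2)[OF f g])
  have "(cmod (a - b))\<^sup>2 = (cmod a)\<^sup>2 + (cmod b)\<^sup>2 - 2 * Re (a * cnj b)" for a b
    by (simp add: cmod_power2 power2_diff)
  then have "(L2_norm (\<lambda>x. f x - g x))\<^sup>2 = (\<integral>x. (cmod (f x))\<^sup>2 + (cmod (g x))\<^sup>2 - 2 * Re (f x * cnj (g x)) \<partial>lborel)"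
    by (simp only: L2_norm_sq)
  also have "\<dots> = (L2_norm f)\<^sup>2 + (L2_norm g)\<^sup>2 - 2 * (\<integral>x. Re (f x * cnj (g x)) \<partial>lborel)"
    using L2_integrable[OF f] L2_integrable[OF g] integrable_Re[OF I] by (simp add: L2_norm_sq del: times_complex.sel)
  also have "(\<integral>x. Re (f x * cnj (g x)) \<partial>lborel) = Re (\<integral>x. f x * cnj (g x) \<partial>lborel)"
    by (rule integral_Re[OF I])
  finally show ?thesis .
qed

context
  fixes h :: "real ^ 'd \<Rightarrow> complex"
  assumes h: "integrable lborel h" and h2: "h \<in> L2"
begin

lemma IFT_L2: "IFT h \<in> L2"
proof (rule L2I)
  note [measurable] = FT_measurable[OF L2_measurable[OF h2]]
  show "IFT h \<in> borel_measurable borel" unfolding IFT_def[abs_def] by measurable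
  show "integrable lborel (\<lambda>x. (cmod (IFT h x))\<^sup>2)"
    using lborel_integrable_reflect[OF L2_integrable[OF FT_L2[OF h h2]], of 0] by (simp add: IFT_def)
qed

lemma L2_norm_IFT: "(L2_norm (IFT h))\<^sup>2 = (2 * pi) ^ CARD('d) * (L2_norm h)\<^sup>2"
proof -
  note [measurable] = FT_measurable[OF L2_measurable[OF h2]]
  have "(L2_norm (IFT h))\<^sup>2 = (L2_norm (FT h))\<^sup>2"
    using lborel_integral_reflect[of "\<lambda>x. (cmod (FT h x))\<^sup>2" 0] by (simp add: IFT_def L2_norm_sq)
  then show ?thesis by (simp only: L2_norm_FT[OF h h2])
qed

lemma parseval_IFT:
  assumes v: "integrable lborel v" and v2: "v \<in> L2"
  shows "(\<integral>x. IFT h x * cnj (v x) \<partial>lborel) = (\<integral>\<xi>. h \<xi> * cnj (FT v \<xi>) \<partial>lborel)"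
proof -
  note [measurable] = L2_measurable[OF h2] L2_measurable[OF v2] FT_measurable
  define w where "w x = cnj (v (- x))" for x
  have w: "integrable lborel w"
    using lborel_integrable_reflect[OF v, of 0] by (simp add: w_def[abs_def])
  have FTw: "FT w \<xi> = cnj (FT v \<xi>)" for \<xi>
  proof -
    have "FT w \<xi> = (\<integral>x. cnj (v x) * exp (\<i> * complex_of_real (x \<bullet> \<xi>)) \<partial>lborel)"
      unfolding FT_def w_def
      using lborel_integral_reflect[of "\<lambda>x. cnj (v x) * exp (\<i> * complex_of_real (x \<bullet> \<xi>))" 0] by simp
    also have "\<dots> = cnj (FT v \<xi>)"
      unfolding FT_def by (subst Bochner_Integration.integral_cnj[symmetric]) (simp add: exp_cnj)
    finally show ?thesis .
  qed
  have "(\<integral>x. IFT h x * cnj (v x) \<partial>lborel) = (\<integral>x. FT h x * w x \<partial>lborel)"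
    unfolding IFT_def w_def using lborel_integral_reflect[of "\<lambda>x. FT h x * cnj (v (- x))" 0] by simp
  also have "\<dots> = (\<integral>\<xi>. h \<xi> * FT w \<xi> \<partial>lborel)"
    by (rule FT_multiplication[OF h w])
  finally show ?thesis by (simp add: FTw)
qed

text \<open>
  The inverse transform and the transform are adjoint up to the factor \<open>(2\<pi>)\<^sup>d\<close> (\<open>parseval_IFT\<close>), and
  each scales norms by a power of it. Expanding both squared distances therefore gives the same
  three terms.
\<close>

lemma L2_norm_IFT_diff_L1:
  assumes v: "integrable lborel v" and v2: "v \<in> L2"
  shows "L2_norm (\<lambda>x. IFT h x - v x) = sqrt ((2 * pi) ^ CARD('d)) * L2_norm (\<lambda>\<xi>. h \<xi> - fourier v \<xi>)"
proof -
  let ?c = "(2 * pi) ^ CARD('d)"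
  have "(\<integral>\<xi>. h \<xi> * cnj (fourier v \<xi>) \<partial>lborel) = (\<integral>\<xi>. of_real (1 / ?c) * (h \<xi> * cnj (FT v \<xi>)) \<partial>lborel)"
    unfolding fourier_eq_FT by (simp add: mult_ac)
  also have "\<dots> = of_real (1 / ?c) * (\<integral>x. IFT h x * cnj (v x) \<partial>lborel)"
    unfolding parseval_IFT[OF v v2] by (rule integral_mult_right_zero)
  finally have "Re (\<integral>x. IFT h x * cnj (v x) \<partial>lborel) = ?c * Re (\<integral>\<xi>. h \<xi> * cnj (fourier v \<xi>) \<partial>lborel)"
    by (simp del: of_real_divide of_real_power of_real_mult)
  then have "(L2_norm (\<lambda>x. IFT h x - v x))\<^sup>2 = ?c * (L2_norm (\<lambda>\<xi>. h \<xi> - fourier v \<xi>))\<^sup>2"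
    unfolding L2_norm_diff_sq[OF IFT_L2 v2] L2_norm_diff_sq[OF h2 fourier_L2_mem[OF v v2]] L2_norm_IFT
    unfolding L2_norm_fourier[OF v v2] power_mult_distrib by (simp add: algebra_simps)
  also have "\<dots> = (sqrt ?c * L2_norm (\<lambda>\<xi>. h \<xi> - fourier v \<xi>))\<^sup>2" by (simp add: power_mult_distrib)
  finally show ?thesis by (subst (asm) power2_eq_iff_nonneg) auto
qed

lemma L2_norm_IFT_diff:
  assumes ug: "is_fourier_L2 u g"
  shows "L2_norm (\<lambda>x. IFT h x - u x) = sqrt ((2 * pi) ^ CARD('d)) * L2_norm (\<lambda>\<xi>. h \<xi> - g \<xi>)"
proof -
  obtain v where v: "\<And>k. integrable lborel (v k)" "\<And>k. v k \<in> L2"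
    and vu: "L2_tendsto v u sequentially" and vg: "L2_tendsto (\<lambda>k. fourier (v k)) g sequentially"
    using ug by (auto simp: is_fourier_L2_def)
  have "(\<lambda>k. L2_norm (\<lambda>x. IFT h x - v k x)) \<longlonglongrightarrow> L2_norm (\<lambda>x. IFT h x - u x)"
    by (intro L2_tendsto_norm L2_tendsto_diff L2_tendsto_const IFT_L2 vu)
  moreover have "(\<lambda>k. sqrt ((2 * pi) ^ CARD('d)) * L2_norm (\<lambda>\<xi>. h \<xi> - fourier (v k) \<xi>)) \<longlonglongrightarrow>
      sqrt ((2 * pi) ^ CARD('d)) * L2_norm (\<lambda>\<xi>. h \<xi> - g \<xi>)"
    by (intro tendsto_mult_left L2_tendsto_norm L2_tendsto_diff L2_tendsto_const h2 vg)
  ultimately show ?thesis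
    unfolding L2_norm_IFT_diff_L1[OF v] by (rule LIMSEQ_unique)
qed

end

lemma is_fourier_L2_add:
  assumes "is_fourier_L2 u g" "is_fourier_L2 u' g'"
  shows "is_fourier_L2 (\<lambda>x. u x + u' x) (\<lambda>\<xi>. g \<xi> + g' \<xi>)"
proof -
  obtain v where v: "\<And>k. integrable lborel (v k)" "\<And>k. v k \<in> L2"
    and vu: "L2_tendsto v u sequentially" and vg: "L2_tendsto (\<lambda>k. fourier (v k)) g sequentially"
    using assms(1) by (auto simp: is_fourier_L2_def)
  obtain v' where v': "\<And>k. integrable lborel (v' k)" "\<And>k. v' k \<in> L2"
    and vu': "L2_tendsto v' u' sequentially" and vg': "L2_tendsto (\<lambda>k. fourier (v' k)) g' sequentially"
    using assms(2) by (auto simp: is_fourier_L2_def)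
  show ?thesis unfolding is_fourier_L2_def
    using L2_tendsto_add[OF vu vu'] L2_tendsto_add[OF vg vg'] v v'
    by (intro exI[of _ "\<lambda>k x. v k x + v' k x"]) (simp add: fourier_add L2_add)
qed

lemma is_fourier_L2_diff:
  assumes "is_fourier_L2 u g" "is_fourier_L2 u' g'"
  shows "is_fourier_L2 (\<lambda>x. u x - u' x) (\<lambda>\<xi>. g \<xi> - g' \<xi>)"
proof -
  obtain v where v: "\<And>k. integrable lborel (v k)" "\<And>k. v k \<in> L2"
    and vu: "L2_tendsto v u sequentially" and vg: "L2_tendsto (\<lambda>k. fourier (v k)) g sequentially"
    using assms(1) by (auto simp: is_fourier_L2_def)
  obtain v' where v': "\<And>k. integrable lborel (v' k)" "\<And>k. v' k \<in> L2"
    and vu': "L2_tendsto v' u' sequentially" and vg': "L2_tendsto (\<lambda>k. fourier (v' k)) g' sequentially"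
    using assms(2) by (auto simp: is_fourier_L2_def)
  show ?thesis unfolding is_fourier_L2_def
    using L2_tendsto_diff[OF vu vu'] L2_tendsto_diff[OF vg vg'] v v'
    by (intro exI[of _ "\<lambda>k x. v k x - v' k x"]) (simp add: fourier_diff L2_diff)
qed

lemma is_fourier_L2_norm:
  fixes u :: "real ^ 'd \<Rightarrow> complex"
  assumes "is_fourier_L2 u g"
  shows "L2_norm u = sqrt ((2 * pi) ^ CARD('d)) * L2_norm g"
proof -
  obtain v where v: "\<And>k. integrable lborel (v k)" "\<And>k. v k \<in> L2"
    and vu: "L2_tendsto v u sequentially" and vg: "L2_tendsto (\<lambda>k. fourier (v k)) g sequentially"
    using assms(1) by (auto simp: is_fourier_L2_def)
  have "(\<lambda>k. L2_norm (v k)) \<longlonglongrightarrow> sqrt ((2 * pi) ^ CARD('d)) * L2_norm g"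
    unfolding L2_norm_fourier[OF v] by (intro tendsto_mult_left L2_tendsto_norm vg)
  with L2_tendsto_norm[OF vu] show ?thesis by (rule LIMSEQ_unique)
qed

lemma is_fourier_L2_mem: "is_fourier_L2 u g \<Longrightarrow> u \<in> L2" "is_fourier_L2 u g \<Longrightarrow> g \<in> L2"
  by (auto simp: is_fourier_L2_def L2_tendsto_def)

lemma is_fourier_L2_cong_AE:
  assumes ug: "is_fourier_L2 u g" and h: "h \<in> L2" and eq: "AE \<xi> in lborel. g \<xi> = h \<xi>"
  shows "is_fourier_L2 u h"
proof -
  obtain v where v: "\<And>k. integrable lborel (v k) \<and> v k \<in> L2"
    and vu: "L2_tendsto v u sequentially" and vg: "L2_tendsto (\<lambda>k. fourier (v k)) g sequentially"
    using ug by (auto simp: is_fourier_L2_def)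
  have g: "g \<in> L2" by (rule is_fourier_L2_mem(2)[OF ug])
  have "L2_norm (\<lambda>\<xi>. fourier (v k) \<xi> - g \<xi>) = L2_norm (\<lambda>\<xi>. fourier (v k) \<xi> - h \<xi>)" for k
    using v[of k] g h eq by (intro L2_norm_AE_cong L2_diff fourier_L2_mem) auto
  then have "L2_tendsto (\<lambda>k. fourier (v k)) h sequentially"
    using vg h by (simp add: L2_tendsto_def)
  with v vu show ?thesis unfolding is_fourier_L2_def by (intro exI[of _ v]) simp
qed

lemma is_fourier_L2_inj:
  assumes u: "is_fourier_L2 u g" and u': "is_fourier_L2 u' g'" and eq: "AE \<xi> in lborel. g \<xi> = g' \<xi>"
  shows "AE x in lborel. u x = u' x"
proof -
  note m = is_fourier_L2_mem[OF u] is_fourier_L2_mem[OF u']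
  have "L2_norm (\<lambda>\<xi>. g \<xi> - g' \<xi>) = L2_norm (\<lambda>_ :: real ^ 'a. 0)"
    using eq m by (intro L2_norm_AE_cong L2_diff) (auto simp: L2_def)
  then have "L2_norm (\<lambda>x. u x - u' x) = 0"
    using is_fourier_L2_norm[OF is_fourier_L2_diff[OF u u']] by (simp add: L2_norm_def)
  from L2_norm_eq_0_AE[OF L2_diff[OF m(1,3)] this] show ?thesis by simp
qed

lemma L2_truncate:
  fixes u :: "real ^ 'd \<Rightarrow> complex"
  assumes u: "u \<in> L2"
  defines "w \<equiv> \<lambda>n x. indicator (cball 0 (real n)) x * u x"
  shows "integrable lborel (w n)" "w n \<in> L2" "L2_tendsto w u sequentially"
proof -
  note [measurable] = L2_measurable[OF u]
  have wm[measurable]: "w n \<in> borel_measurable borel" for n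
  proof -
    have [measurable]: "cball (0 :: real ^ 'd) (real n) \<in> sets borel" by simp
    show ?thesis unfolding w_def by measurable
  qed
  show w2: "w n \<in> L2" for n
    by (rule L2_bounded[OF wm u]) (simp add: w_def norm_mult indicator_def)
  show "integrable lborel (w n)"
  proof (rule Bochner_Integration.integrable_bound)
    have "emeasure lborel (cball (0 :: real ^ 'd) (real n)) < \<infinity>"
      by (rule emeasure_lborel_cball_finite)
    then have "integrable lborel (indicator (cball 0 (real n)) :: real ^ 'd \<Rightarrow> real)"
      by (auto simp: integrable_indicator_iff)
    then show "integrable lborel (\<lambda>x. indicator (cball 0 (real n)) x + (cmod (u x))\<^sup>2 :: real)"
      using L2_integrable[OF u] by simp
    have "cmod z \<le> 1 + (cmod z)\<^sup>2" for z
    proof -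
      have "2 * cmod z \<le> 1 + (cmod z)\<^sup>2" using sum_squares_bound[of 1 "cmod z"] by simp
      then show ?thesis using norm_ge_zero[of z] by linarith
    qed
    then show "AE x in lborel. norm (w n x) \<le> norm (indicator (cball 0 (real n)) x + (cmod (u x))\<^sup>2 :: real)"
      by (auto simp: w_def indicator_def norm_mult)
  qed simp
  have "(\<lambda>n. \<integral>x. (cmod (w n x - u x))\<^sup>2 \<partial>lborel) \<longlonglongrightarrow> (\<integral>x. 0 \<partial>(lborel :: (real ^ 'd) measure))"
  proof (rule integral_dominated_convergence[where w="\<lambda>x. (cmod (u x))\<^sup>2"])
    show "AE x in lborel. (\<lambda>n. (cmod (w n x - u x))\<^sup>2) \<longlonglongrightarrow> 0"
    proof (rule AE_I2)
      fix x :: "real ^ 'd"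
      have "\<forall>\<^sub>F n in sequentially. norm x \<le> real n"
        by (meson eventually_sequentiallyI nat_ceiling_le_eq)
      then have "\<forall>\<^sub>F n in sequentially. (cmod (w n x - u x))\<^sup>2 = 0"
        by eventually_elim (simp add: w_def)
      then show "(\<lambda>n. (cmod (w n x - u x))\<^sup>2) \<longlonglongrightarrow> 0" by (rule tendsto_eventually)
    qed
  qed (use L2_integrable[OF u] in \<open>auto simp: w_def indicator_def\<close>)
  then have "(\<lambda>n. sqrt (\<integral>x. (cmod (w n x - u x))\<^sup>2 \<partial>lborel)) \<longlonglongrightarrow> sqrt 0"
    by (intro tendsto_real_sqrt) simp
  then show "L2_tendsto w u sequentially"
    using u w2 by (simp add: L2_tendsto_def L2_norm_def)
qed

text \<open>
  Truncation to balls gives integrable approximations. A subsequence with geometrically decreasing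
  errors has transforms to which \<open>L2_complete_fast\<close> applies, by Plancherel's theorem.
\<close>

lemma is_fourier_L2_exists:
  fixes u :: "real ^ 'd \<Rightarrow> complex"
  assumes u: "u \<in> L2"
  shows "\<exists>g. is_fourier_L2 u g"
proof -
  obtain w :: "nat \<Rightarrow> real ^ 'd \<Rightarrow> complex" where w: "\<And>n. integrable lborel (w n)" "\<And>n. w n \<in> L2" "L2_tendsto w u sequentially"
    by (rule that[OF L2_truncate[OF u]])
  have "\<exists>n. L2_norm (\<lambda>x. w n x - u x) < (1/2) ^ k" for k
    using order_tendstoD(2)[of "\<lambda>n. L2_norm (\<lambda>x. w n x - u x)" 0 sequentially "(1/2) ^ k"] w(3)
    by (auto simp: L2_tendsto_def eventually_sequentially)
  then obtain r where r: "\<And>k. L2_norm (\<lambda>x. w (r k) x - u x) < (1/2) ^ k" by metis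
  let ?c = "(2 * pi) ^ CARD('d)"
  have lim: "L2_tendsto (\<lambda>k. w (r k)) u sequentially"
  proof -
    have "(\<lambda>k. L2_norm (\<lambda>x. w (r k) x - u x)) \<longlonglongrightarrow> 0"
    proof (rule tendsto_sandwich[OF _ _ tendsto_const])
      show "(\<lambda>k. (1/2) ^ k :: real) \<longlonglongrightarrow> 0" by (rule LIMSEQ_power_zero) simp
      show "\<forall>\<^sub>F k in sequentially. L2_norm (\<lambda>x. w (r k) x - u x) \<le> (1/2) ^ k"
        using less_imp_le[OF r] by (rule always_eventually[OF allI])
    qed simp
    then show ?thesis using u w(2) by (simp add: L2_tendsto_def)
  qed
  have "\<exists>g. L2_tendsto (\<lambda>k. fourier (w (r k))) g sequentially"
  proof (rule L2_complete_fast)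
    show "fourier (w (r k)) \<in> L2" for k by (rule fourier_L2_mem[OF w(1,2)])
    fix k
    have "sqrt ?c * L2_norm (\<lambda>\<xi>. fourier (w (r (Suc k))) \<xi> - fourier (w (r k)) \<xi>) = L2_norm (\<lambda>x. w (r (Suc k)) x - w (r k) x)"
      using L2_norm_fourier[of "\<lambda>x. w (r (Suc k)) x - w (r k) x"] w(1,2) by (simp add: L2_diff fourier_diff)
    also have "\<dots> \<le> L2_norm (\<lambda>x. w (r (Suc k)) x - u x) + L2_norm (\<lambda>x. u x - w (r k) x)"
      using w(2) u by (intro L2_norm_triangle_dist)
    also have "\<dots> \<le> (1/2) ^ Suc k + (1/2) ^ k"
      using r[of k] r[of "Suc k"] by (intro add_mono) (auto simp: L2_norm_minus_commute[of u])
    also have "\<dots> \<le> 2 * (1/2) ^ k" by simp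
    finally show "L2_norm (\<lambda>\<xi>. fourier (w (r (Suc k))) \<xi> - fourier (w (r k)) \<xi>) \<le> 2 / sqrt ?c * (1/2) ^ k"
      by (simp add: field_simps)
  qed
  then obtain g where "L2_tendsto (\<lambda>k. fourier (w (r k))) g sequentially" ..
  then show ?thesis using lim w(1,2) unfolding is_fourier_L2_def
    by (intro exI[of _ g] exI[of _ "\<lambda>k. w (r k)"]) simp
qed

lemma is_fourier_L2_fourier_L2:
  assumes "u \<in> L2"
  shows "is_fourier_L2 u (fourier_L2 u)"
  unfolding fourier_L2_def using is_fourier_L2_exists[OF assms] by (rule someI_ex)

section \<open>Exponentially decaying weights\<close>

text \<open>
  By the Taylor bound \<open>1 + t\<^sup>2 \<le> 2 e\<^bsup>|t|\<^esup>\<close>, the density \<open>2 / (1 + t\<^sup>2)\<close> dominates.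
\<close>

lemma integrable_exp_neg_abs:
  assumes "0 < a"
  shows "integrable lborel (\<lambda>t::real. exp (- a * \<bar>t\<bar>))"
proof -
  have 1: "integrable lborel (\<lambda>t::real. 2 * inverse (1 + t\<^sup>2))"
    using integrable_inverse_1_plus_square by (simp add: set_integrable_def einterval_eq_UNIV)
  have "integrable lborel (\<lambda>t::real. exp (- \<bar>t\<bar>))"
  proof (rule Bochner_Integration.integrable_bound[OF 1])
    have "exp (- \<bar>t\<bar>) \<le> 2 * inverse (1 + t\<^sup>2)" for t :: real
    proof -
      have "1 + t\<^sup>2 \<le> 2 * exp \<bar>t\<bar>"
        using exp_lower_Taylor_quadratic[of "\<bar>t\<bar>"] by (simp add: field_simps)
      moreover have "0 < 1 + t\<^sup>2" by (simp add: add_pos_nonneg)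
      ultimately show ?thesis by (simp add: exp_minus field_simps)
    qed
    then show "AE t::real in lborel. norm (exp (- \<bar>t\<bar>)) \<le> norm (2 * inverse (1 + t\<^sup>2))"
      by (intro AE_I2) (simp add: add_nonneg_nonneg)
  qed simp
  from lborel_integrable_real_affine[OF this, of a 0] assms show ?thesis
    by (simp add: abs_mult)
qed

text \<open>
  The norm is at least the mean of the absolute values of the coordinates, so a product of
  one-dimensional exponentials dominates.
\<close>

lemma integrable_exp_neg_norm:
  assumes a: "0 < a"
  shows "integrable lborel (\<lambda>\<xi>::'a::euclidean_space. exp (- a * norm \<xi>))"
proof (rule Bochner_Integration.integrable_bound)
  define b where "b = a / DIM('a)"
  have b: "0 < b" using a by (simp add: b_def)
  show "integrable lborel (\<lambda>\<xi>::'a. \<Prod>i\<in>Basis. exp (- b * \<bar>\<xi> \<bullet> i\<bar>))"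
    by (intro integrable_lborel_prod integrable_exp_neg_abs b)
  have "exp (- a * norm \<xi>) \<le> (\<Prod>i\<in>Basis. exp (- b * \<bar>\<xi> \<bullet> i\<bar>))" for \<xi> :: 'a
  proof -
    have "b * (\<Sum>i\<in>Basis. \<bar>\<xi> \<bullet> i\<bar>) \<le> b * (\<Sum>i\<in>(Basis::'a set). norm \<xi>)"
      using b by (intro mult_left_mono sum_mono Basis_le_norm) auto
    also have "\<dots> = a * norm \<xi>" by (simp add: b_def)
    finally show ?thesis
      by (simp add: exp_sum[symmetric] sum_distrib_left sum_negf)
  qed
  then show "AE \<xi>::'a in lborel. norm (exp (- a * norm \<xi>)) \<le> norm (\<Prod>i\<in>Basis. exp (- b * \<bar>\<xi> \<bullet> i\<bar>))"
    by (intro AE_I2) (simp add: prod_nonneg)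
qed simp

text \<open>
  The exponential is itself in \<open>L\<^sup>2\<close>, and half of its decay absorbs polynomial factors. These are the
  bounds behind the integral, the second-order remainder and the derivative of \<open>laplace f\<close>.
\<close>

lemma L2_exp_decay_integrable:
  fixes f :: "real ^ 'd \<Rightarrow> complex"
  assumes f: "f \<in> L2" and a: "0 < a"
  shows "integrable lborel (\<lambda>\<xi>. exp (- a * norm \<xi>) * cmod (f \<xi>))"
    "integrable lborel (\<lambda>\<xi>. (norm \<xi>)\<^sup>2 * exp (- a * norm \<xi>) * cmod (f \<xi>))"
    "integrable lborel (\<lambda>\<xi>. norm \<xi> * exp (- a * norm \<xi>) * cmod (f \<xi>))"
proof -
  note [measurable] = L2_measurable[OF f]
  have E: "(\<lambda>\<xi>::real ^ 'd. complex_of_real (exp (- b * norm \<xi>))) \<in> L2" if "0 < b" for b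
  proof (rule L2I)
    have "(cmod (complex_of_real (exp (- b * norm \<xi>))))\<^sup>2 = exp (- (2 * b) * norm \<xi>)" for \<xi> :: "real ^ 'd"
      by (simp add: power2_eq_square exp_add[symmetric])
    then show "integrable lborel (\<lambda>\<xi>::real ^ 'd. (cmod (complex_of_real (exp (- b * norm \<xi>))))\<^sup>2)"
      using integrable_exp_neg_norm[of "2 * b", where 'a="real ^ 'd"] that by simp
  qed measurable
  have 0: "integrable lborel (\<lambda>\<xi>. exp (- b * norm \<xi>) * cmod (f \<xi>))" if "0 < b" for b
    using integrable_norm[OF L2_mult_integrable(1)[OF E[OF that] f]] by (simp add: norm_mult)
  show "integrable lborel (\<lambda>\<xi>. exp (- a * norm \<xi>) * cmod (f \<xi>))" by (rule 0[OF a])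
  have sq: "s\<^sup>2 * exp (- a * s) \<le> 8 / a\<^sup>2 * exp (- (a / 2) * s)" if "0 \<le> s" for s :: real
  proof -
    have "(a / 2 * s)\<^sup>2 / 2 \<le> exp (a / 2 * s)"
      using exp_lower_Taylor_quadratic[of "a / 2 * s"] that a by (smt (verit) mult_nonneg_nonneg divide_nonneg_pos)
    then have "s\<^sup>2 \<le> 8 / a\<^sup>2 * exp (a / 2 * s)"
      using a by (simp add: field_simps power2_eq_square)
    then have "s\<^sup>2 * exp (- a * s) \<le> 8 / a\<^sup>2 * exp (a / 2 * s) * exp (- a * s)"
      by (intro mult_right_mono) auto
    also have "\<dots> = 8 / a\<^sup>2 * exp (- (a / 2) * s)"
      by (simp add: mult.assoc exp_add[symmetric])
    finally show ?thesis .
  qed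
  show 2: "integrable lborel (\<lambda>\<xi>. (norm \<xi>)\<^sup>2 * exp (- a * norm \<xi>) * cmod (f \<xi>))"
  proof (rule Bochner_Integration.integrable_bound)
    show "integrable lborel (\<lambda>\<xi>. 8 / a\<^sup>2 * (exp (- (a / 2) * norm \<xi>) * cmod (f \<xi>)))"
      using a by (intro integrable_mult_right 0) auto
    show "AE \<xi> in lborel. norm ((norm \<xi>)\<^sup>2 * exp (- a * norm \<xi>) * cmod (f \<xi>))
      \<le> norm (8 / a\<^sup>2 * (exp (- (a / 2) * norm \<xi>) * cmod (f \<xi>)))"
    proof (rule AE_I2)
      fix \<xi> :: "real ^ 'd"
      show "norm ((norm \<xi>)\<^sup>2 * exp (- a * norm \<xi>) * cmod (f \<xi>))
        \<le> norm (8 / a\<^sup>2 * (exp (- (a / 2) * norm \<xi>) * cmod (f \<xi>)))"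
        using mult_right_mono[OF sq[of "norm \<xi>"], of "cmod (f \<xi>)"]
        by (simp add: abs_mult mult.assoc)
    qed
  qed measurable
  show "integrable lborel (\<lambda>\<xi>. norm \<xi> * exp (- a * norm \<xi>) * cmod (f \<xi>))"
  proof (rule Bochner_Integration.integrable_bound)
    show "integrable lborel (\<lambda>\<xi>. exp (- a * norm \<xi>) * cmod (f \<xi>) + (norm \<xi>)\<^sup>2 * exp (- a * norm \<xi>) * cmod (f \<xi>))"
      using 0[OF a] 2 by (rule Bochner_Integration.integrable_add)
    show "AE \<xi> in lborel. norm (norm \<xi> * exp (- a * norm \<xi>) * cmod (f \<xi>))
      \<le> norm (exp (- a * norm \<xi>) * cmod (f \<xi>) + (norm \<xi>)\<^sup>2 * exp (- a * norm \<xi>) * cmod (f \<xi>))"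
    proof (rule AE_I2)
      fix \<xi> :: "real ^ 'd"
      have "2 * norm \<xi> \<le> 1 + (norm \<xi>)\<^sup>2" using sum_squares_bound[of 1 "norm \<xi>"] by simp
      then have "norm \<xi> \<le> 1 + (norm \<xi>)\<^sup>2" using norm_ge_zero[of \<xi>] by linarith
      then have "norm \<xi> * (exp (- a * norm \<xi>) * cmod (f \<xi>)) \<le> (1 + (norm \<xi>)\<^sup>2) * (exp (- a * norm \<xi>) * cmod (f \<xi>))"
        by (rule mult_right_mono) simp
      then show "norm (norm \<xi> * exp (- a * norm \<xi>) * cmod (f \<xi>))
        \<le> norm (exp (- a * norm \<xi>) * cmod (f \<xi>) + (norm \<xi>)\<^sup>2 * exp (- a * norm \<xi>) * cmod (f \<xi>))"
        by (simp add: algebra_simps)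
    qed
  qed measurable
qed

section \<open>The bilinear pairing, dual cones and tubes\<close>

lemma pairing_add: "pairing (z + h) \<xi> = pairing z \<xi> + pairing h \<xi>"
  by (simp add: pairing_def distrib_right sum.distrib)

lemma pairing_scale: "pairing (c *s z) \<xi> = c * pairing z \<xi>"
  by (simp add: pairing_def sum_distrib_left mult.assoc)

lemma pairing_scaleR: "pairing (r *\<^sub>R z) \<xi> = of_real r * pairing z \<xi>"
  unfolding pairing_def sum_distrib_left vector_scaleR_component by (intro sum.cong) (simp_all add: scaleR_conv_of_real)

lemma Im_pairing: "Im (pairing z \<xi>) = (\<chi> j. Im (z $ j)) \<bullet> \<xi>"
  by (simp add: pairing_def inner_vec_def)

lemma norm_pairing_le: "cmod (pairing z \<xi>) \<le> norm z * norm \<xi>"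
proof -
  have "cmod (pairing z \<xi>) \<le> (\<Sum>j\<in>UNIV. \<bar>cmod (z $ j)\<bar> * \<bar>norm (\<xi> $ j)\<bar>)"
    unfolding pairing_def by (rule order_trans[OF norm_sum]) (simp add: norm_mult)
  also have "\<dots> \<le> norm z * norm \<xi>"
    unfolding norm_vec_def by (rule L2_set_mult_ineq)
  finally show ?thesis .
qed

lemma pairing_measurable [measurable]: "pairing z \<in> borel_measurable borel"
  unfolding pairing_def[abs_def] by (intro borel_measurable_continuous_onI continuous_intros)

lemma pairing_slice:
  "pairing (\<chi> j. Complex (x $ j) (y $ j)) \<xi> = complex_of_real (x \<bullet> \<xi>) + \<i> * complex_of_real (y \<bullet> \<xi>)"
proof -
  have "pairing (\<chi> j. Complex (x $ j) (y $ j)) \<xi> =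
      (\<Sum>j\<in>UNIV. complex_of_real (x $ j * \<xi> $ j) + \<i> * complex_of_real (y $ j * \<xi> $ j))"
    unfolding pairing_def by (intro sum.cong) (simp_all add: complex_eq_iff)
  then show ?thesis by (simp add: inner_vec_def sum.distrib sum_distrib_left)
qed

lemma cmod_exp_pairing: "cmod (exp (\<i> * pairing z \<xi>)) = exp (- ((\<chi> j. Im (z $ j)) \<bullet> \<xi>))"
  by (simp add: Im_pairing)

text \<open>
  A ball around \<open>y\<close> lies in \<open>\<Omega>\<close>. Moving from \<open>y\<close> in the direction \<open>-\<xi>\<close> to the boundary of that ball
  keeps the inner product with \<open>\<xi>\<close> nonnegative.
\<close>

lemma dual_cone_coercive:
  assumes "open \<Omega>" "y \<in> \<Omega>"
  obtains a where "0 < a" "\<And>\<xi>. \<xi> \<in> dual_cone \<Omega> \<Longrightarrow> a * norm \<xi> \<le> y \<bullet> \<xi>"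
proof -
  obtain e where e: "0 < e" "cball y e \<subseteq> \<Omega>"
    using assms by (meson open_contains_cball)
  have "e * norm \<xi> \<le> y \<bullet> \<xi>" if \<xi>: "\<xi> \<in> dual_cone \<Omega>" for \<xi>
  proof (cases "\<xi> = 0")
    case False
    have "y - (e / norm \<xi>) *\<^sub>R \<xi> \<in> cball y e" using e False by (simp add: dist_norm)
    with e(2) have "y - (e / norm \<xi>) *\<^sub>R \<xi> \<in> \<Omega>" by blast
    with \<xi> have "0 \<le> (y - (e / norm \<xi>) *\<^sub>R \<xi>) \<bullet> \<xi>" unfolding dual_cone_def by blast
    also have "\<dots> = y \<bullet> \<xi> - e * norm \<xi>"
      using False by (simp add: inner_diff_left dot_square_norm power2_eq_square)
    finally show ?thesis by simp
  qed simp
  with e(1) that show ?thesis by blast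
qed

lemma closed_dual_cone: "closed (dual_cone \<Omega>)"
proof -
  have "dual_cone \<Omega> = (\<Inter>x\<in>\<Omega>. {\<xi>. 0 \<le> x \<bullet> \<xi>})" by (auto simp: dual_cone_def)
  then show ?thesis by (auto intro!: closed_INT closed_halfspace_ge simp: closed_halfspace_ge[of _ 0, simplified])
qed

lemma dual_cone_borel [measurable]: "dual_cone \<Omega> \<in> sets borel"
  by (rule borel_closed[OF closed_dual_cone])

lemma dual_cone_uminus: "dual_cone (uminus ` \<Omega>) = uminus ` dual_cone \<Omega>"
proof (intro set_eqI iffI)
  fix \<xi> assume "\<xi> \<in> dual_cone (uminus ` \<Omega>)"
  then have "- \<xi> \<in> dual_cone \<Omega>" by (simp add: dual_cone_def)
  then show "\<xi> \<in> uminus ` dual_cone \<Omega>" by (metis imageI minus_minus)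
qed (auto simp: dual_cone_def)

lemma dual_cone_Int_uminus:
  assumes "open \<Omega>" "\<Omega> \<noteq> {}" "\<xi> \<in> dual_cone \<Omega>" "\<xi> \<in> uminus ` dual_cone \<Omega>"
  shows "\<xi> = 0"
proof -
  obtain y where "y \<in> \<Omega>" using assms by auto
  from dual_cone_coercive[OF assms(1) this] obtain a where
    a: "0 < a" "\<And>\<xi>. \<xi> \<in> dual_cone \<Omega> \<Longrightarrow> a * norm \<xi> \<le> y \<bullet> \<xi>" by blast
  have "- \<xi> \<in> dual_cone \<Omega>" using assms(4) by auto
  then have "a * norm \<xi> + a * norm \<xi> \<le> 0" using a(2)[OF assms(3)] a(2)[of "- \<xi>"] by simp
  then show ?thesis using a(1) by (smt (verit) mult_pos_pos zero_less_norm_iff)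
qed

lemma at_0_within_cone:
  assumes "open_convex_cone \<Omega>" "\<Omega> \<noteq> {}"
  shows "at 0 within \<Omega> \<noteq> bot"
proof -
  have "open \<Omega>" using assms by (simp add: open_convex_cone_def)
  then have "\<Omega> \<noteq> {0}" using not_open_singleton by metis
  then obtain x where x: "x \<in> \<Omega>" "x \<noteq> 0" using assms(2) by auto
  have "0 islimpt \<Omega>"
    unfolding islimpt_approachable
  proof (intro allI impI)
    fix e :: real assume e: "0 < e"
    have "(e / (2 * norm x)) *\<^sub>R x \<in> \<Omega>"
      using assms x e by (auto simp: open_convex_cone_def)
    then show "\<exists>x'\<in>\<Omega>. x' \<noteq> 0 \<and> dist x' 0 < e"
      using x e by (intro bexI[of _ "(e / (2 * norm x)) *\<^sub>R x"]) auto
  qed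
  then show ?thesis using trivial_limit_within by (auto simp: trivial_limit_def)
qed

lemma open_convex_cone_uminus:
  assumes "open_convex_cone \<Omega>"
  shows "open_convex_cone (uminus ` \<Omega>)"
  using assms unfolding open_convex_cone_def
  by (auto simp: open_negations convex_negations image_iff)

lemma open_tube:
  assumes "open \<Omega>"
  shows "open (tube \<Omega>)"
proof -
  have "open ((\<lambda>z. \<chi> j. Im (z $ j)) -` \<Omega>)"
    by (intro open_vimage assms continuous_intros)
  then show ?thesis by (simp add: tube_def vimage_def)
qed

lemma at_0_within_uminus: "at 0 within (uminus ` \<Omega>) = filtermap uminus (at 0 within \<Omega>)"
  for \<Omega> :: "'a::real_normed_vector set"
proof (rule filter_eqI)
  fix P :: "'a \<Rightarrow> bool"
  show "eventually P (at 0 within (uminus ` \<Omega>)) \<longleftrightarrow> eventually P (filtermap uminus (at 0 within \<Omega>))"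
    by (simp add: eventually_filtermap eventually_at)
qed

lemma L2_tendsto_reflect:
  "L2_tendsto (\<lambda>y. f (- y)) u (at 0 within \<Omega>) \<longleftrightarrow> L2_tendsto f u (at 0 within (uminus ` \<Omega>))"
  for \<Omega> :: "'a::real_normed_vector set"
  by (simp add: L2_tendsto_def at_0_within_uminus eventually_filtermap filterlim_filtermap)

section \<open>Holomorphy of Fourier-Laplace integrals\<close>

definition laplace :: "(real ^ 'd \<Rightarrow> complex) \<Rightarrow> complex ^ 'd \<Rightarrow> complex" where
  "laplace f z = (\<integral>\<xi>. exp (\<i> * pairing z \<xi>) * f \<xi> \<partial>lborel)"

text \<open>
  Differentiation under the integral sign in all directions at once. For \<open>|h| \<le> a/2\<close>, half of the decay
  \<open>e\<^bsup>-a|\<xi>|\<^esup>\<close> absorbs the growth of \<open>e\<^bsup>i\<langle>h,\<xi>\<rangle>\<^esup>\<close>, so the second-order Taylor remainder of the exponential is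
  bounded by \<open>|h|\<^sup>2\<close> times a fixed integrable function.
\<close>

lemma laplace_has_derivative:
  fixes f :: "real ^ 'd \<Rightarrow> complex"
  assumes \<Omega>: "open \<Omega>" and f: "f \<in> L2" and supp: "\<And>\<xi>. \<xi> \<notin> dual_cone \<Omega> \<Longrightarrow> f \<xi> = 0"
    and z: "z \<in> tube \<Omega>"
  defines "D \<equiv> \<lambda>h. \<integral>\<xi>. \<i> * pairing h \<xi> * (exp (\<i> * pairing z \<xi>) * f \<xi>) \<partial>lborel"
  shows "(laplace f has_derivative D) (at z)"
    and "D (c *s h) = c * D h"
proof -
  note [measurable] = L2_measurable[OF f]
  obtain a where a: "0 < a" and coercive: "\<And>\<xi>. \<xi> \<in> dual_cone \<Omega> \<Longrightarrow> a * norm \<xi> \<le> (\<chi> j. Im (z $ j)) \<bullet> \<xi>"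
    using dual_cone_coercive[OF \<Omega>, of "\<chi> j. Im (z $ j)"] z unfolding tube_def by blast
  define E where "E \<xi> = exp (\<i> * pairing z \<xi>) * f \<xi>" for \<xi>
  have E_meas[measurable]: "E \<in> borel_measurable borel" unfolding E_def by measurable
  have E_le: "cmod (E \<xi>) \<le> exp (- a * norm \<xi>) * cmod (f \<xi>)" for \<xi>
  proof (cases "\<xi> \<in> dual_cone \<Omega>")
    case True
    then show ?thesis unfolding E_def norm_mult cmod_exp_pairing
      using coercive[OF True] by (intro mult_right_mono) auto
  qed (simp add: E_def supp)
  have int_E: "integrable lborel (\<lambda>\<xi>. exp (\<i> * pairing h \<xi>) * E \<xi>)" if h: "norm h \<le> a / 2" for h
  proof (rule Bochner_Integration.integrable_bound)
    show "integrable lborel (\<lambda>\<xi>. exp (- (a / 2) * norm \<xi>) * cmod (f \<xi>))"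
      using a by (intro L2_exp_decay_integrable(1)[OF f]) simp
    show "AE \<xi> in lborel. norm (exp (\<i> * pairing h \<xi>) * E \<xi>) \<le> norm (exp (- (a / 2) * norm \<xi>) * cmod (f \<xi>))"
    proof (rule AE_I2)
      fix \<xi> :: "real ^ 'd"
      have "norm h * norm \<xi> \<le> a / 2 * norm \<xi>" using h by (intro mult_right_mono) auto
      moreover have "Re (\<i> * pairing h \<xi>) \<le> norm h * norm \<xi>"
        using norm_pairing_le[of h \<xi>] abs_Im_le_cmod[of "pairing h \<xi>"] by simp
      ultimately have "cmod (exp (\<i> * pairing h \<xi>)) \<le> exp (a / 2 * norm \<xi>)"
        by simp
      then have "norm (exp (\<i> * pairing h \<xi>) * E \<xi>) \<le> exp (a / 2 * norm \<xi>) * (exp (- a * norm \<xi>) * cmod (f \<xi>))"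
        unfolding norm_mult using E_le by (intro mult_mono) auto
      also have "\<dots> = exp (- (a / 2) * norm \<xi>) * cmod (f \<xi>)"
        by (simp add: mult.assoc[symmetric] exp_add[symmetric])
      finally show "norm (exp (\<i> * pairing h \<xi>) * E \<xi>) \<le> norm (exp (- (a / 2) * norm \<xi>) * cmod (f \<xi>))" by simp
    qed
  qed measurable
  have D_le: "cmod (\<i> * pairing h \<xi> * E \<xi>) \<le> norm h * (norm \<xi> * exp (- a * norm \<xi>) * cmod (f \<xi>))" for h \<xi>
  proof -
    have "cmod (\<i> * pairing h \<xi> * E \<xi>) \<le> (norm h * norm \<xi>) * (exp (- a * norm \<xi>) * cmod (f \<xi>))"
      unfolding norm_mult[of "\<i> * pairing h \<xi>"] using norm_pairing_le[of h \<xi>]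
      by (intro mult_mono E_le) (auto simp: norm_mult)
    then show ?thesis by (simp add: mult_ac)
  qed
  have int_D: "integrable lborel (\<lambda>\<xi>. \<i> * pairing h \<xi> * E \<xi>)" for h
  proof (rule Bochner_Integration.integrable_bound)
    show "integrable lborel (\<lambda>\<xi>. norm h * (norm \<xi> * exp (- a * norm \<xi>) * cmod (f \<xi>)))"
      by (intro integrable_mult_right L2_exp_decay_integrable(3)[OF f a])
    show "AE \<xi> in lborel. norm (\<i> * pairing h \<xi> * E \<xi>) \<le> norm (norm h * (norm \<xi> * exp (- a * norm \<xi>) * cmod (f \<xi>)))"
    proof (rule AE_I2)
      fix \<xi> :: "real ^ 'd"
      show "norm (\<i> * pairing h \<xi> * E \<xi>) \<le> norm (norm h * (norm \<xi> * exp (- a * norm \<xi>) * cmod (f \<xi>)))"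
        by (rule order_trans[OF D_le]) simp
    qed
  qed measurable
  have D_eq: "D h = (\<integral>\<xi>. \<i> * pairing h \<xi> * E \<xi> \<partial>lborel)" for h
    by (simp add: D_def E_def)
  show D_scale: "D (c *s h) = c * D h" for c h
  proof -
    have "D (c *s h) = (\<integral>\<xi>. c * (\<i> * pairing h \<xi> * E \<xi>) \<partial>lborel)"
      unfolding D_eq by (simp add: pairing_scale mult_ac)
    then show ?thesis unfolding D_eq by simp
  qed
  define K where "K = (\<integral>\<xi>. norm \<xi> * exp (- a * norm \<xi>) * cmod (f \<xi>) \<partial>lborel)"
  have lin: "bounded_linear D"
  proof (rule bounded_linear_intro)
    show "D (h + k) = D h + D k" for h k
      using int_D[of h] int_D[of k] unfolding D_eq by (simp add: pairing_add algebra_simps)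
    show "D (r *\<^sub>R h) = r *\<^sub>R D h" for r h
    proof -
      have "D (r *\<^sub>R h) = (\<integral>\<xi>. of_real r * (\<i> * pairing h \<xi> * E \<xi>) \<partial>lborel)"
        unfolding D_eq by (simp add: pairing_scaleR mult_ac)
      then show ?thesis unfolding D_eq by (simp add: scaleR_conv_of_real)
    qed
    show "norm (D h) \<le> norm h * K" for h
    proof -
      have "norm (D h) \<le> (\<integral>\<xi>. cmod (\<i> * pairing h \<xi> * E \<xi>) \<partial>lborel)"
        unfolding D_eq by (rule integral_norm_bound)
      also have "\<dots> \<le> (\<integral>\<xi>. norm h * (norm \<xi> * exp (- a * norm \<xi>) * cmod (f \<xi>)) \<partial>lborel)"
        by (intro integral_mono integrable_norm[OF int_D] integrable_mult_right L2_exp_decay_integrable(3)[OF f a] D_le)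
      finally show ?thesis by (simp add: K_def)
    qed
  qed
  define M where "M = (\<integral>\<xi>. (norm \<xi>)\<^sup>2 * exp (- (a / 2) * norm \<xi>) * cmod (f \<xi>) \<partial>lborel)"
  note int_M = L2_exp_decay_integrable(2)[OF f half_gt_zero[OF a]]
  have remainder: "cmod (laplace f (z + h) - laplace f z - D h) \<le> (norm h)\<^sup>2 * M" if h: "norm h \<le> a / 2" for h
  proof -
    have L: "laplace f (z + h) = (\<integral>\<xi>. exp (\<i> * pairing h \<xi>) * E \<xi> \<partial>lborel)"
      unfolding laplace_def E_def by (simp add: pairing_add distrib_left exp_add mult_ac)
    have L0: "laplace f z = (\<integral>\<xi>. E \<xi> \<partial>lborel)" by (simp add: laplace_def E_def)
    have pw: "cmod (exp (\<i> * pairing h \<xi>) * E \<xi> - E \<xi> - \<i> * pairing h \<xi> * E \<xi>) \<le>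
        (norm h)\<^sup>2 * ((norm \<xi>)\<^sup>2 * exp (- (a / 2) * norm \<xi>) * cmod (f \<xi>))" for \<xi>
    proof -
      let ?w = "\<i> * pairing h \<xi>"
      have w: "cmod ?w \<le> norm h * norm \<xi>" using norm_pairing_le[of h \<xi>] by (simp add: norm_mult)
      have "cmod (exp ?w - (\<Sum>i\<le>1. ?w ^ i / fact i)) \<le> exp (cmod ?w) * (cmod ?w ^ Suc 1) / fact 1"
        by (rule Taylor_exp_field)
      then have "cmod (exp ?w - 1 - ?w) \<le> exp (cmod ?w) * (cmod ?w)\<^sup>2"
        by (simp add: numeral_2_eq_2 diff_diff_eq)
      also have "\<dots> \<le> exp (a / 2 * norm \<xi>) * (norm h * norm \<xi>)\<^sup>2"
      proof (intro mult_mono power_mono w)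
        have "norm h * norm \<xi> \<le> a / 2 * norm \<xi>" using h by (intro mult_right_mono) auto
        then show "exp (cmod ?w) \<le> exp (a / 2 * norm \<xi>)" using w by simp
      qed auto
      finally have "cmod ((exp ?w - 1 - ?w) * E \<xi>) \<le>
          (exp (a / 2 * norm \<xi>) * (norm h * norm \<xi>)\<^sup>2) * (exp (- a * norm \<xi>) * cmod (f \<xi>))"
        unfolding norm_mult[of "exp ?w - 1 - ?w"] using E_le by (intro mult_mono) auto
      also have "\<dots> = (norm h)\<^sup>2 * ((norm \<xi>)\<^sup>2 * (exp (a / 2 * norm \<xi>) * exp (- a * norm \<xi>)) * cmod (f \<xi>))"
        by (simp add: power_mult_distrib mult_ac)
      also have "exp (a / 2 * norm \<xi>) * exp (- a * norm \<xi>) = exp (- (a / 2) * norm \<xi>)"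
        by (simp add: exp_add[symmetric])
      finally show ?thesis by (simp add: algebra_simps)
    qed
    have int0: "integrable lborel E" using int_E[of 0] a by (simp add: pairing_def)
    note ints = int_E[OF h] int0 int_D[of h]
    have "laplace f (z + h) - laplace f z - D h =
        (\<integral>\<xi>. exp (\<i> * pairing h \<xi>) * E \<xi> - E \<xi> - \<i> * pairing h \<xi> * E \<xi> \<partial>lborel)"
      unfolding L L0 D_eq using ints by simp
    also have "cmod \<dots> \<le> (\<integral>\<xi>. cmod (exp (\<i> * pairing h \<xi>) * E \<xi> - E \<xi> - \<i> * pairing h \<xi> * E \<xi>) \<partial>lborel)"
      by (rule integral_norm_bound)
    also have "\<dots> \<le> (\<integral>\<xi>. (norm h)\<^sup>2 * ((norm \<xi>)\<^sup>2 * exp (- (a / 2) * norm \<xi>) * cmod (f \<xi>)) \<partial>lborel)"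
      by (intro integral_mono integrable_norm Bochner_Integration.integrable_diff ints integrable_mult_right int_M pw)
    finally show ?thesis by (simp add: M_def)
  qed
  show "(laplace f has_derivative D) (at z)"
    unfolding has_derivative_at
  proof (intro conjI lin, rule Lim_null_comparison)
    have "\<forall>\<^sub>F h in at 0. h \<noteq> 0 \<and> norm h \<le> a / 2"
      unfolding eventually_at using a by (intro exI[of _ "a / 2"] conjI) (simp_all add: less_imp_le)
    then show "\<forall>\<^sub>F h in at 0. norm (norm (laplace f (z + h) - laplace f z - D h) / norm h) \<le> norm h * M"
    proof eventually_elim
      case (elim h)
      then show ?case using remainder[of h] by (simp add: field_simps power2_eq_square)
    qed
    have "((\<lambda>h::complex ^ 'd. norm h * M) \<longlongrightarrow> norm (0 :: complex ^ 'd) * M) (at 0)"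
      by (rule tendsto_mult_right[OF tendsto_norm[OF tendsto_ident_at]])
    then show "((\<lambda>h::complex ^ 'd. norm h * M) \<longlongrightarrow> 0) (at 0)" by simp
  qed
qed

lemma holomorphic_laplace:
  assumes "open \<Omega>" "f \<in> L2" "\<And>\<xi>. \<xi> \<notin> dual_cone \<Omega> \<Longrightarrow> f \<xi> = 0" "\<And>z. z \<in> tube \<Omega> \<Longrightarrow> F z = laplace f z"
  shows "holomorphic_Cn F (tube \<Omega>)"
  unfolding holomorphic_Cn_def
proof
  fix z assume z: "z \<in> tube \<Omega>"
  note D = laplace_has_derivative[OF assms(1-3) z]
  show "\<exists>D. (F has_derivative D) (at z) \<and> (\<forall>c v. D (c *s v) = c * D v)"
  proof (intro exI conjI allI)
    show "(F has_derivative (\<lambda>h. \<integral>\<xi>. \<i> * pairing h \<xi> * (exp (\<i> * pairing z \<xi>) * f \<xi>) \<partial>lborel)) (at z)"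
      by (rule has_derivative_transform_within_open[OF D(1) open_tube[OF assms(1)] z])
        (assumption | rule assms(4)[symmetric])+
  qed (rule D(2))
qed

section \<open>Boundary values\<close>

definition damp :: "real ^ 'd \<Rightarrow> (real ^ 'd \<Rightarrow> complex) \<Rightarrow> real ^ 'd \<Rightarrow> complex" where
  "damp y f \<xi> = of_real (exp (- (y \<bullet> \<xi>))) * f \<xi>"

lemma slice_laplace: "slice (laplace f) y = IFT (damp y f)"
proof
  fix x
  have "exp (\<i> * (complex_of_real (x \<bullet> \<xi>) + \<i> * complex_of_real (y \<bullet> \<xi>))) =
      exp (\<i> * complex_of_real (x \<bullet> \<xi>)) * of_real (exp (- (y \<bullet> \<xi>)))" for \<xi>
  proof -
    have "\<i> * (complex_of_real (x \<bullet> \<xi>) + \<i> * complex_of_real (y \<bullet> \<xi>)) =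
        \<i> * complex_of_real (x \<bullet> \<xi>) + complex_of_real (- (y \<bullet> \<xi>))"
      by (simp add: algebra_simps)
    then show ?thesis by (simp only: exp_add exp_of_real)
  qed
  then show "slice (laplace f) y x = IFT (damp y f) x"
    by (simp add: slice_def laplace_def IFT_eq damp_def pairing_slice mult.assoc)
qed

context
  fixes \<Omega> :: "(real ^ 'd) set" and f :: "real ^ 'd \<Rightarrow> complex"
  assumes \<Omega>: "open \<Omega>" and f: "f \<in> L2" and supp: "\<And>\<xi>. \<xi> \<notin> dual_cone \<Omega> \<Longrightarrow> f \<xi> = 0"
begin

lemma damp_le:
  assumes "y \<in> \<Omega>"
  shows "cmod (damp y f \<xi>) \<le> cmod (f \<xi>)"
proof (cases "\<xi> \<in> dual_cone \<Omega>")
  case True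
  then have "0 \<le> y \<bullet> \<xi>" using assms by (simp add: dual_cone_def)
  then show ?thesis by (simp add: damp_def norm_mult mult_left_le_one_le)
qed (simp add: supp damp_def)

lemma damp_measurable [measurable]: "damp y f \<in> borel_measurable borel"
  using L2_measurable[OF f] unfolding damp_def[abs_def] by measurable

lemma damp_L2: "y \<in> \<Omega> \<Longrightarrow> damp y f \<in> L2"
  by (rule L2_bounded[OF damp_measurable f damp_le])

lemma damp_integrable:
  assumes y: "y \<in> \<Omega>"
  shows "integrable lborel (damp y f)"
proof -
  obtain a where a: "0 < a" and coercive: "\<And>\<xi>. \<xi> \<in> dual_cone \<Omega> \<Longrightarrow> a * norm \<xi> \<le> y \<bullet> \<xi>"
    using dual_cone_coercive[OF \<Omega> y] by blast
  show ?thesis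
  proof (rule Bochner_Integration.integrable_bound[OF L2_exp_decay_integrable(1)[OF f a]])
    have "cmod (damp y f \<xi>) \<le> exp (- a * norm \<xi>) * cmod (f \<xi>)" for \<xi>
      using coercive[of \<xi>] supp[of \<xi>]
      by (cases "\<xi> \<in> dual_cone \<Omega>") (auto simp: damp_def norm_mult intro!: mult_right_mono)
    then show "AE \<xi> in lborel. norm (damp y f \<xi>) \<le> norm (exp (- a * norm \<xi>) * cmod (f \<xi>))"
      by (intro AE_I2) simp
  qed simp
qed

lemma damp_tendsto: "L2_tendsto (\<lambda>y. damp y f) f (at 0 within \<Omega>)"
  unfolding L2_tendsto_def
proof (intro conjI f)
  show "\<forall>\<^sub>F y in at 0 within \<Omega>. damp y f \<in> L2"
    unfolding eventually_at_filter by (intro always_eventually) (auto intro: damp_L2)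
  note [measurable] = L2_measurable[OF f]
  show "((\<lambda>y. L2_norm (\<lambda>\<xi>. damp y f \<xi> - f \<xi>)) \<longlongrightarrow> 0) (at 0 within \<Omega>)"
    unfolding tendsto_at_iff_sequentially comp_def
  proof (intro allI impI)
    fix Y assume Y: "\<forall>i. Y i \<in> \<Omega> - {0}" "Y \<longlonglongrightarrow> 0"
    have "(\<lambda>i. \<integral>\<xi>. (cmod (damp (Y i) f \<xi> - f \<xi>))\<^sup>2 \<partial>lborel) \<longlonglongrightarrow> (\<integral>\<xi>. 0 \<partial>(lborel :: (real ^ 'd) measure))"
    proof (rule integral_dominated_convergence[where w="\<lambda>\<xi>. 4 * (cmod (f \<xi>))\<^sup>2"])
      show "AE \<xi> in lborel. (\<lambda>i. (cmod (damp (Y i) f \<xi> - f \<xi>))\<^sup>2) \<longlonglongrightarrow> 0"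
      proof (rule AE_I2)
        fix \<xi> :: "real ^ 'd"
        have "(\<lambda>i. (cmod (damp (Y i) f \<xi> - f \<xi>))\<^sup>2) \<longlonglongrightarrow> (cmod (of_real (exp (- (0 \<bullet> \<xi>))) * f \<xi> - f \<xi>))\<^sup>2"
          unfolding damp_def by (intro tendsto_intros Y)
        then show "(\<lambda>i. (cmod (damp (Y i) f \<xi> - f \<xi>))\<^sup>2) \<longlonglongrightarrow> 0" by simp
      qed
      show "AE \<xi> in lborel. norm ((cmod (damp (Y i) f \<xi> - f \<xi>))\<^sup>2) \<le> 4 * (cmod (f \<xi>))\<^sup>2" for i
      proof (rule AE_I2)
        fix \<xi> :: "real ^ 'd"
        have "cmod (damp (Y i) f \<xi> - f \<xi>) \<le> 2 * cmod (f \<xi>)"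
          using norm_triangle_ineq4[of "damp (Y i) f \<xi>" "f \<xi>"] damp_le[of "Y i" \<xi>] Y(1) by force
        then have "(cmod (damp (Y i) f \<xi> - f \<xi>))\<^sup>2 \<le> (2 * cmod (f \<xi>))\<^sup>2" by (intro power_mono) auto
        then show "norm ((cmod (damp (Y i) f \<xi> - f \<xi>))\<^sup>2) \<le> 4 * (cmod (f \<xi>))\<^sup>2"
          by (simp add: power_mult_distrib)
      qed
    qed (use L2_integrable[OF f] in auto)
    then have "(\<lambda>i. sqrt (\<integral>\<xi>. (cmod (damp (Y i) f \<xi> - f \<xi>))\<^sup>2 \<partial>lborel)) \<longlonglongrightarrow> sqrt 0"
      by (intro tendsto_real_sqrt) simp
    then show "(\<lambda>i. L2_norm (\<lambda>\<xi>. damp (Y i) f \<xi> - f \<xi>)) \<longlonglongrightarrow> 0"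
      by (simp add: L2_norm_def)
  qed
qed

text \<open>
  By Plancherel's theorem the distance between the slice at \<open>y\<close> and \<open>u\<close> is a multiple of the distance
  between the damped density and \<open>g\<close>, which tends to the distance between \<open>f\<close> and \<open>g\<close>.
\<close>

lemma boundary_value_iff:
  assumes ug: "is_fourier_L2 u g" and nontriv: "at 0 within \<Omega> \<noteq> bot"
    and F: "\<And>z. z \<in> tube \<Omega> \<Longrightarrow> F z = laplace f z"
  shows "L2_tendsto (slice F) u (at 0 within \<Omega>) \<longleftrightarrow> (AE \<xi> in lborel. f \<xi> = g \<xi>)"
proof -
  let ?A = "at 0 within \<Omega>" and ?s = "sqrt ((2 * pi) ^ CARD('d))"
  have u: "u \<in> L2" and g: "g \<in> L2" using is_fourier_L2_mem[OF ug] by auto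
  have slice: "slice F y = IFT (damp y f)" if "y \<in> \<Omega>" for y
  proof -
    have "(\<chi> j. Complex (x $ j) (y $ j)) \<in> tube \<Omega>" for x
      using that by (simp add: tube_def)
    then have "slice F y = slice (laplace f) y" by (simp add: slice_def fun_eq_iff F)
    then show ?thesis by (simp add: slice_laplace)
  qed
  have ev: "\<forall>\<^sub>F y in ?A. y \<in> \<Omega>" unfolding eventually_at_filter by (intro always_eventually) auto
  have "((\<lambda>y. ?s * L2_norm (\<lambda>\<xi>. damp y f \<xi> - g \<xi>)) \<longlongrightarrow> ?s * L2_norm (\<lambda>\<xi>. f \<xi> - g \<xi>)) ?A"
    by (intro tendsto_mult_left L2_tendsto_norm L2_tendsto_diff damp_tendsto L2_tendsto_const g)
  moreover have "\<forall>\<^sub>F y in ?A. ?s * L2_norm (\<lambda>\<xi>. damp y f \<xi> - g \<xi>) = L2_norm (\<lambda>x. slice F y x - u x)"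
    using ev by eventually_elim (simp add: slice L2_norm_IFT_diff[OF damp_integrable damp_L2 ug])
  ultimately have lim: "((\<lambda>y. L2_norm (\<lambda>x. slice F y x - u x)) \<longlongrightarrow> ?s * L2_norm (\<lambda>\<xi>. f \<xi> - g \<xi>)) ?A"
    by (rule Lim_transform_eventually)
  have mem: "\<forall>\<^sub>F y in ?A. slice F y \<in> L2"
    using ev by eventually_elim (simp add: slice IFT_L2[OF damp_integrable damp_L2])
  have "L2_tendsto (slice F) u ?A \<longleftrightarrow> ((\<lambda>y. L2_norm (\<lambda>x. slice F y x - u x)) \<longlongrightarrow> 0) ?A"
    using u mem by (simp add: L2_tendsto_def)
  also have "\<dots> \<longleftrightarrow> ?s * L2_norm (\<lambda>\<xi>. f \<xi> - g \<xi>) = 0"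
  proof
    assume "((\<lambda>y. L2_norm (\<lambda>x. slice F y x - u x)) \<longlongrightarrow> 0) ?A"
    then show "?s * L2_norm (\<lambda>\<xi>. f \<xi> - g \<xi>) = 0" by (rule tendsto_unique[OF nontriv lim])
  qed (use lim in \<open>simp only:\<close>)
  also have "\<dots> \<longleftrightarrow> L2_norm (\<lambda>\<xi>. f \<xi> - g \<xi>) = 0" by simp
  also have "\<dots> \<longleftrightarrow> (AE \<xi> in lborel. f \<xi> = g \<xi>)"
  proof
    assume "AE \<xi> in lborel. f \<xi> = g \<xi>"
    then have "L2_norm (\<lambda>\<xi>. f \<xi> - g \<xi>) = L2_norm (\<lambda>_ :: real ^ 'd. 0)"
      using f g by (intro L2_norm_AE_cong L2_diff) (auto simp: L2_def)
    then show "L2_norm (\<lambda>\<xi>. f \<xi> - g \<xi>) = 0" by (simp add: L2_norm_def)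
  next
    assume "L2_norm (\<lambda>\<xi>. f \<xi> - g \<xi>) = 0"
    from L2_norm_eq_0_AE[OF L2_diff[OF f g] this] show "AE \<xi> in lborel. f \<xi> = g \<xi>" by simp
  qed
  finally show ?thesis .
qed

end

section \<open>Spectral spaces over a cone\<close>

lemma L2_weighted_restrict_L2:
  fixes f :: "real ^ 'd \<Rightarrow> complex"
  assumes f: "f \<in> L2_weighted C w" and w: "\<And>\<xi>. \<xi> \<in> C \<Longrightarrow> 1 \<le> w \<xi>"
  shows "(\<lambda>\<xi>. indicator C \<xi> * f \<xi>) \<in> L2"
proof (rule L2I)
  have eq: "indicator C \<xi> *\<^sub>R f \<xi> = indicator C \<xi> * f \<xi>" for \<xi> by (simp add: indicator_def)
  show meas: "(\<lambda>\<xi>. indicator C \<xi> * f \<xi>) \<in> borel_measurable borel"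
    using f by (simp add: L2_weighted_def set_borel_measurable_def eq)
  show "integrable lborel (\<lambda>\<xi>. (cmod (indicator C \<xi> * f \<xi>))\<^sup>2)"
  proof (rule Bochner_Integration.integrable_bound)
    show "integrable lborel (\<lambda>\<xi>. indicator C \<xi> *\<^sub>R ((cmod (f \<xi>))\<^sup>2 * w \<xi>))"
      using f by (simp add: L2_weighted_def set_integrable_def)
    show "AE \<xi> in lborel. norm ((cmod (indicator C \<xi> * f \<xi>))\<^sup>2) \<le> norm (indicator C \<xi> *\<^sub>R ((cmod (f \<xi>))\<^sup>2 * w \<xi>))"
    proof (rule AE_I2)
      fix \<xi> :: "real ^ 'd"
      show "norm ((cmod (indicator C \<xi> * f \<xi>))\<^sup>2) \<le> norm (indicator C \<xi> *\<^sub>R ((cmod (f \<xi>))\<^sup>2 * w \<xi>))"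
        using w[of \<xi>] mult_left_mono[of 1 "w \<xi>" "(cmod (f \<xi>))\<^sup>2"]
          by (cases "\<xi> \<in> C") (auto simp: abs_mult)
    qed
  qed (use meas in measurable)
qed

lemma L2_weighted_norm_AE_cong:
  assumes "f \<in> L2_weighted C w" "g \<in> L2_weighted C w" "AE \<xi> in lborel. \<xi> \<in> C \<longrightarrow> f \<xi> = g \<xi>"
  shows "L2_weighted_norm C w f = L2_weighted_norm C w g"
  unfolding L2_weighted_norm_def set_lebesgue_integral_def
proof (intro arg_cong[where f=sqrt] integral_cong_AE)
  show "AE \<xi> in lborel. indicator C \<xi> *\<^sub>R ((cmod (f \<xi>))\<^sup>2 * w \<xi>) = indicator C \<xi> *\<^sub>R ((cmod (g \<xi>))\<^sup>2 * w \<xi>)"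
    using assms(3) by eventually_elim (simp add: indicator_def)
qed (use assms in \<open>auto simp: L2_weighted_def set_integrable_def\<close>)

lemma represents_laplace: 
  "represents T C f F \<longleftrightarrow> (\<forall>z\<in>T. F z = laplace (\<lambda>\<xi>. indicator C \<xi> * f \<xi>) z)"
proof -
  have "(\<integral>\<xi>\<in>C. exp (\<i> * pairing z \<xi>) * f \<xi> \<partial>lborel) = laplace (\<lambda>\<xi>. indicator C \<xi> * f \<xi>) z" for z
    unfolding laplace_def set_lebesgue_integral_def
    by (intro Bochner_Integration.integral_cong) (auto simp: indicator_def)
  then show ?thesis by (simp add: represents_def)
qed

text \<open>
  One cone and a function \<open>u\<close> whose transform \<open>g\<close> is supported in its dual: applied to \<open>\<Omega>\<close> and to \<open>-\<Omega>\<close>,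
  the following lemmas give the two summands of the decomposition.
\<close>

context
  fixes \<Omega> :: "(real ^ 'd) set" and w :: "real ^ 'd \<Rightarrow> real" and u g :: "real ^ 'd \<Rightarrow> complex"
  assumes cone: "open_convex_cone \<Omega>" "\<Omega> \<noteq> {}"
    and w: "\<And>\<xi>. \<xi> \<in> dual_cone \<Omega> \<Longrightarrow> 1 \<le> w \<xi>"
    and ug: "is_fourier_L2 u g" and gw: "g \<in> L2_weighted (dual_cone \<Omega>) w"
    and g0: "AE \<xi> in lborel. \<xi> \<notin> dual_cone \<Omega> \<longrightarrow> g \<xi> = 0"
begin

lemma hardy_boundary_iff:
  assumes f: "f \<in> L2_weighted (dual_cone \<Omega>) w" and F: "represents (tube \<Omega>) (dual_cone \<Omega>) f F"
  shows "L2_tendsto (slice F) u (at 0 within \<Omega>) \<longleftrightarrow> (AE \<xi> in lborel. \<xi> \<in> dual_cone \<Omega> \<longrightarrow> f \<xi> = g \<xi>)"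
proof -
  have "L2_tendsto (slice F) u (at 0 within \<Omega>) \<longleftrightarrow> (AE \<xi> in lborel. indicator (dual_cone \<Omega>) \<xi> * f \<xi> = g \<xi>)"
    using cone F L2_weighted_restrict_L2[OF f w]
    by (intro boundary_value_iff at_0_within_cone ug) (auto simp: represents_laplace open_convex_cone_def)
  also have "\<dots> \<longleftrightarrow> (AE \<xi> in lborel. \<xi> \<in> dual_cone \<Omega> \<longrightarrow> f \<xi> = g \<xi>)"
    by (rule eventually_subst, use g0 in eventually_elim) (auto simp: indicator_def)
  finally show ?thesis .
qed

lemma hardy_unique:
  assumes F: "F \<in> spectral_space (tube \<Omega>) (dual_cone \<Omega>) w" "L2_tendsto (slice F) u (at 0 within \<Omega>)"
    and G: "G \<in> spectral_space (tube \<Omega>) (dual_cone \<Omega>) w" "L2_tendsto (slice G) u (at 0 within \<Omega>)"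
  shows "F = G"
proof -
  obtain f where f: "f \<in> L2_weighted (dual_cone \<Omega>) w" "represents (tube \<Omega>) (dual_cone \<Omega>) f F"
    using F(1) by (auto simp: spectral_space_def)
  obtain h where h: "h \<in> L2_weighted (dual_cone \<Omega>) w" "represents (tube \<Omega>) (dual_cone \<Omega>) h G"
    using G(1) by (auto simp: spectral_space_def)
  have "AE \<xi> in lborel. \<xi> \<in> dual_cone \<Omega> \<longrightarrow> f \<xi> = g \<xi>"
    using hardy_boundary_iff[OF f] F(2) by simp
  moreover have "AE \<xi> in lborel. \<xi> \<in> dual_cone \<Omega> \<longrightarrow> h \<xi> = g \<xi>"
    using hardy_boundary_iff[OF h] G(2) by simp
  ultimately have AE: "AE \<xi> in lborel. indicator (dual_cone \<Omega>) \<xi> * f \<xi> = indicator (dual_cone \<Omega>) \<xi> * h \<xi>"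
    by eventually_elim (simp add: indicator_def)
  note meas = L2_measurable[OF L2_weighted_restrict_L2[OF f(1) w]] L2_measurable[OF L2_weighted_restrict_L2[OF h(1) w]]
  have "laplace (\<lambda>\<xi>. indicator (dual_cone \<Omega>) \<xi> * f \<xi>) z = laplace (\<lambda>\<xi>. indicator (dual_cone \<Omega>) \<xi> * h \<xi>) z" for z
    unfolding laplace_def
  proof (rule integral_cong_AE)
    show "AE \<xi> in lborel. exp (\<i> * pairing z \<xi>) * (indicator (dual_cone \<Omega>) \<xi> * f \<xi>) =
        exp (\<i> * pairing z \<xi>) * (indicator (dual_cone \<Omega>) \<xi> * h \<xi>)"
      using AE by eventually_elim simp
  qed (use meas in \<open>auto intro!: borel_measurable_times\<close>)
  then have "F z = G z" if "z \<in> tube \<Omega>" for z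
    using f(2) h(2) that by (simp add: represents_laplace)
  moreover have "F \<in> extensional (tube \<Omega>)" "G \<in> extensional (tube \<Omega>)"
    using F G by (auto simp: spectral_space_def)
  ultimately show ?thesis by (intro extensionalityI)
qed

lemma hardy_exists:
  "\<exists>F \<in> spectral_space (tube \<Omega>) (dual_cone \<Omega>) w. L2_tendsto (slice F) u (at 0 within \<Omega>)"
proof -
  define F where "F = restrict (laplace (\<lambda>\<xi>. indicator (dual_cone \<Omega>) \<xi> * g \<xi>)) (tube \<Omega>)"
  have F: "represents (tube \<Omega>) (dual_cone \<Omega>) g F"
    by (simp add: represents_laplace F_def)
  have "holomorphic_Cn F (tube \<Omega>)"
    using cone F L2_weighted_restrict_L2[OF gw w]
    by (intro holomorphic_laplace[where f="\<lambda>\<xi>. indicator (dual_cone \<Omega>) \<xi> * g \<xi>"])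
      (auto simp: represents_laplace open_convex_cone_def)
  then have "F \<in> spectral_space (tube \<Omega>) (dual_cone \<Omega>) w"
    using F gw unfolding spectral_space_def by (auto simp: F_def)
  then show ?thesis using hardy_boundary_iff[OF gw F] by auto
qed

text \<open>
  The infimum is over a singleton: every representing density agrees with \<open>g\<close> almost everywhere on the
  dual cone.
\<close>

lemma hardy_norm:
  assumes F: "F \<in> spectral_space (tube \<Omega>) (dual_cone \<Omega>) w" "L2_tendsto (slice F) u (at 0 within \<Omega>)"
  shows "spectral_norm (tube \<Omega>) (dual_cone \<Omega>) w F = L2_weighted_norm (dual_cone \<Omega>) w g"
proof -
  let ?S = "{f \<in> L2_weighted (dual_cone \<Omega>) w. represents (tube \<Omega>) (dual_cone \<Omega>) f F}"
  have eq: "L2_weighted_norm (dual_cone \<Omega>) w f = L2_weighted_norm (dual_cone \<Omega>) w g" if "f \<in> ?S" for f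
    using that hardy_boundary_iff[of f F] F(2) by (intro L2_weighted_norm_AE_cong gw) auto
  have "?S \<noteq> {}" using F(1) unfolding spectral_space_def by blast
  then have "L2_weighted_norm (dual_cone \<Omega>) w ` ?S = (\<lambda>_. L2_weighted_norm (dual_cone \<Omega>) w g) ` ?S"
    using eq by (intro image_cong refl)
  also have "\<dots> = {L2_weighted_norm (dual_cone \<Omega>) w g}"
    by (rule image_constant_conv[THEN trans]) (use \<open>?S \<noteq> {}\<close> in \<open>simp only: if_False\<close>)
  finally show ?thesis by (simp add: spectral_norm_def)
qed

end

section \<open>The boundary decomposition\<close>

lemma weight_ge_1: "1 \<le> weight \<rho> n \<xi>"
proof -
  have "\<rho> \<xi> ^ (2 * 0) \<le> (\<Sum>k=0..n. \<rho> \<xi> ^ (2 * k))"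
    by (rule member_le_sum) (auto simp: power_mult)
  then show ?thesis by (simp add: weight_def)
qed

lemma L2_weighted_norm_sq:
  assumes "\<And>\<xi>. \<xi> \<in> C \<Longrightarrow> 0 \<le> w \<xi>"
  shows "(L2_weighted_norm C w f)\<^sup>2 = (\<integral>\<xi>. indicator C \<xi> *\<^sub>R ((cmod (f \<xi>))\<^sup>2 * w \<xi>) \<partial>lborel)"
proof -
  have "0 \<le> (\<integral>\<xi>. indicator C \<xi> *\<^sub>R ((cmod (f \<xi>))\<^sup>2 * w \<xi>) \<partial>lborel)"
    using assms by (intro integral_nonneg_AE AE_I2) (auto simp: indicator_def)
  then show ?thesis by (simp add: L2_weighted_norm_def set_lebesgue_integral_def)
qed

text \<open>
  The complement of the essential support is a union of open sets on which \<open>g\<close> vanishes almost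
  everywhere; by Lindelof's theorem countably many of them suffice.
\<close>

lemma AE_ess_supp: "AE \<xi> in lborel. \<xi> \<notin> ess_supp g \<longrightarrow> g \<xi> = 0"
proof -
  define \<F> where "\<F> = {U. open U \<and> (AE \<xi> in lborel. \<xi> \<in> U \<longrightarrow> g \<xi> = 0)}"
  have "\<And>S. S \<in> \<F> \<Longrightarrow> open S" by (simp add: \<F>_def)
  from Lindelof[OF this] obtain \<G> where \<G>: "\<G> \<subseteq> \<F>" "countable \<G>" "\<Union>\<G> = \<Union>\<F>" by blast
  have "AE \<xi> in lborel. \<forall>U\<in>\<G>. \<xi> \<in> U \<longrightarrow> g \<xi> = 0"
    using \<G>(1,2) by (subst AE_ball_countable) (auto simp: \<F>_def)
  then show ?thesis
  proof eventually_elim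
    case (elim \<xi>)
    have "ess_supp g = - \<Union>\<G>" unfolding \<G>(3) by (simp add: ess_supp_def \<F>_def)
    with elim show ?case by auto
  qed
qed

text \<open>
  Here \<open>g\<close> is the transform of the whole function and \<open>u\<close> one of its two spectral components. The
  transform of \<open>u\<close> is determined only up to a null set, so it is replaced by the pointwise product with
  the indicator, which has the same weighted integrand on the cone as \<open>g\<close>.
\<close>

lemma spectral_component:
  assumes cone: "open_convex_cone \<Omega>" "\<Omega> \<noteq> {}"
    and w: "\<And>\<xi>. \<xi> \<in> dual_cone \<Omega> \<Longrightarrow> 1 \<le> w \<xi>"
    and u: "u \<in> L2" "AE \<xi> in lborel. fourier_L2 u \<xi> = indicator (dual_cone \<Omega>) \<xi> * g \<xi>"
    and g: "g \<in> L2" "integrable lborel (\<lambda>\<xi>. indicator (dual_cone \<Omega>) \<xi> *\<^sub>R ((cmod (g \<xi>))\<^sup>2 * w \<xi>))"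
  shows "is_fourier_L2 u (\<lambda>\<xi>. indicator (dual_cone \<Omega>) \<xi> * g \<xi>)" (is ?fourier)
    and "\<exists>!F. F \<in> spectral_space (tube \<Omega>) (dual_cone \<Omega>) w \<and> L2_tendsto (slice F) u (at 0 within \<Omega>)" (is ?ex1)
    and "F \<in> spectral_space (tube \<Omega>) (dual_cone \<Omega>) w \<Longrightarrow> L2_tendsto (slice F) u (at 0 within \<Omega>) \<Longrightarrow>
      (spectral_norm (tube \<Omega>) (dual_cone \<Omega>) w F)\<^sup>2 =
      (\<integral>\<xi>. indicator (dual_cone \<Omega>) \<xi> *\<^sub>R ((cmod (g \<xi>))\<^sup>2 * w \<xi>) \<partial>lborel)" (is "?mem \<Longrightarrow> ?lim \<Longrightarrow> ?norm")
proof -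
  let ?C = "dual_cone \<Omega>" and ?h = "\<lambda>\<xi>. indicator (dual_cone \<Omega>) \<xi> * g \<xi>"
  note [measurable] = L2_measurable[OF g(1)]
  have h_meas[measurable]: "?h \<in> borel_measurable borel" by measurable
  have h: "?h \<in> L2"
    by (rule L2_bounded[OF h_meas g(1)]) (simp add: norm_mult indicator_def)
  show fourier: ?fourier
    by (rule is_fourier_L2_cong_AE[OF is_fourier_L2_fourier_L2[OF u(1)] h u(2)])
  have eq: "indicator ?C \<xi> *\<^sub>R ((cmod (?h \<xi>))\<^sup>2 * w \<xi>) = indicator ?C \<xi> *\<^sub>R ((cmod (g \<xi>))\<^sup>2 * w \<xi>)" for \<xi>
    by (simp add: indicator_def)
  have "set_borel_measurable lborel ?C ?h"
    unfolding set_borel_measurable_def by measurable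
  then have hw: "?h \<in> L2_weighted ?C w"
    using g(2) unfolding L2_weighted_def set_integrable_def mem_Collect_eq eq by (rule conjI)
  have h0: "AE \<xi> in lborel. \<xi> \<notin> ?C \<longrightarrow> ?h \<xi> = 0" by simp
  note hardy = cone w fourier hw h0
  show ?ex1
    using hardy_exists[OF hardy] hardy_unique[OF hardy] by blast
  show ?norm if "?mem" "?lim"
  proof -
    have "spectral_norm (tube \<Omega>) ?C w F = L2_weighted_norm ?C w ?h"
      by (rule hardy_norm[OF hardy that])
    moreover have "0 \<le> w \<xi>" if "\<xi> \<in> ?C" for \<xi>
      using w[OF that] by simp
    ultimately show ?thesis by (simp only: L2_weighted_norm_sq eq)
  qed
qed

theorem theorem5p3:
  fixes \<Omega> :: "(real ^ 'd) set" and \<rho> :: "real ^ 'd \<Rightarrow> real" and n :: nat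
    and u u\<^sub>p u\<^sub>m :: "real ^ 'd \<Rightarrow> complex"
  assumes "\<Omega> \<noteq> {}" and "open_convex_cone \<Omega>" and "\<not> contains_line \<Omega>"
    and "continuous_on (dual_cone \<Omega>) \<rho>"
    and "\<And>\<xi>. \<xi> \<in> dual_cone \<Omega> \<Longrightarrow> 0 \<le> \<rho> \<xi>"
    and "\<And>\<xi>. \<xi> \<in> dual_cone \<Omega> \<Longrightarrow> \<xi> \<noteq> 0 \<Longrightarrow> 0 < \<rho> \<xi>"
    and "\<And>t \<xi>. 0 < t \<Longrightarrow> \<xi> \<in> dual_cone \<Omega> \<Longrightarrow> \<rho> (t *\<^sub>R \<xi>) = t * \<rho> \<xi>"
    and "u \<in> W_space n \<rho> \<Omega>"
    and "u\<^sub>p \<in> L2" and "u\<^sub>m \<in> L2"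
    and "AE \<xi> in lborel. fourier_L2 u\<^sub>p \<xi> = indicator (dual_cone \<Omega>) \<xi> * fourier_L2 u \<xi>"
    and "AE \<xi> in lborel. fourier_L2 u\<^sub>m \<xi> = indicator (uminus ` dual_cone \<Omega>) \<xi> * fourier_L2 u \<xi>"
  shows "\<exists>!(F\<^sub>p, F\<^sub>m).
      F\<^sub>p \<in> H_plus n \<rho> \<Omega> \<and> F\<^sub>m \<in> H_minus n \<rho> \<Omega> \<and>
      L2_tendsto (slice F\<^sub>p) u\<^sub>p (at 0 within \<Omega>) \<and>
      L2_tendsto (\<lambda>y. slice F\<^sub>m (- y)) u\<^sub>m (at 0 within \<Omega>) \<and>
      (AE x in lborel. u x = u\<^sub>p x + u\<^sub>m x) \<and>
      (W_norm n \<rho> \<Omega> u)\<^sup>2 = (H_plus_norm n \<rho> \<Omega> F\<^sub>p)\<^sup>2 + (H_minus_norm n \<rho> \<Omega> F\<^sub>m)\<^sup>2"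
proof -
  let ?C = "dual_cone \<Omega>" and ?C' = "uminus ` dual_cone \<Omega>" and ?N = "uminus ` \<Omega>"
  let ?w = "weight \<rho> n" and ?w' = "\<lambda>\<eta>. weight \<rho> n (- \<eta>)" and ?g = "fourier_L2 u"
  let ?S = "sym_cone \<Omega>" and ?sw = "sym_weight n \<rho> \<Omega>"
  have open\<Omega>: "open \<Omega>" using assms(2) by (simp add: open_convex_cone_def)
  have cone': "open_convex_cone ?N" "?N \<noteq> {}"
    using open_convex_cone_uminus[OF assms(2)] assms(1) by auto
  have u: "u \<in> L2" and supp: "ess_supp ?g \<subseteq> ?S"
    and gw: "integrable lborel (\<lambda>\<xi>. indicator ?S \<xi> *\<^sub>R ((cmod (?g \<xi>))\<^sup>2 * ?sw \<xi>))"
    using assms(8) by (auto simp: W_space_def L2_weighted_def set_integrable_def)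
  have fourier_u: "is_fourier_L2 u ?g" by (rule is_fourier_L2_fourier_L2[OF u])
  have g: "?g \<in> L2" by (rule is_fourier_L2_mem(2)[OF fourier_u])
  have C'_borel: "?C' \<in> sets lborel" unfolding dual_cone_uminus[symmetric] by simp
  have disj: "\<xi> = 0" if "\<xi> \<in> ?C" "\<xi> \<in> ?C'" for \<xi>
    by (rule dual_cone_Int_uminus[OF open\<Omega> assms(1) that])
  have restrict: "indicator ?C \<xi> *\<^sub>R (indicator ?S \<xi> *\<^sub>R ((cmod (?g \<xi>))\<^sup>2 * ?sw \<xi>)) =
      indicator ?C \<xi> *\<^sub>R ((cmod (?g \<xi>))\<^sup>2 * ?w \<xi>)" for \<xi>
    by (simp add: indicator_def sym_cone_def sym_weight_def)
  \<comment> \<open>At the common point 0 the two weights agree, so this holds without exceptional set.\<close>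
  have restrict': "indicator ?C' \<xi> *\<^sub>R (indicator ?S \<xi> *\<^sub>R ((cmod (?g \<xi>))\<^sup>2 * ?sw \<xi>)) =
      indicator ?C' \<xi> *\<^sub>R ((cmod (?g \<xi>))\<^sup>2 * ?w' \<xi>)" for \<xi>
    using disj[of \<xi>] by (cases "\<xi> \<in> ?C") (auto simp: indicator_def sym_cone_def sym_weight_def)
  have int: "integrable lborel (\<lambda>\<xi>. indicator ?C \<xi> *\<^sub>R ((cmod (?g \<xi>))\<^sup>2 * ?w \<xi>))"
    using integrable_mult_indicator[OF _ gw, of ?C] unfolding restrict by simp
  have int': "integrable lborel (\<lambda>\<xi>. indicator ?C' \<xi> *\<^sub>R ((cmod (?g \<xi>))\<^sup>2 * ?w' \<xi>))"
    using integrable_mult_indicator[OF C'_borel gw] unfolding restrict' .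
  note plus = spectral_component[OF assms(2,1) weight_ge_1 assms(9,11) g int]
  note minus = spectral_component[OF cone', of ?w', unfolded dual_cone_uminus, OF weight_ge_1 assms(10,12) g int']

  have nz: "AE \<xi> in lborel. \<xi> \<noteq> (0 :: real ^ 'd)" by (rule AE_lborel_singleton)
  have split: "AE \<xi> in lborel. indicator ?C \<xi> * ?g \<xi> + indicator ?C' \<xi> * ?g \<xi> = ?g \<xi>"
    using AE_ess_supp[of ?g] nz
  proof eventually_elim
    case (elim \<xi>)
    show ?case
    proof (cases "\<xi> \<in> ?S")
      case True
      then show ?thesis using disj[of \<xi>] elim(2) by (auto simp: sym_cone_def indicator_def)
    next
      case False
      then show ?thesis using elim(1) supp by auto
    qed
  qed
  have sum: "AE x in lborel. u x = u\<^sub>p x + u\<^sub>m x"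
    using is_fourier_L2_inj[OF is_fourier_L2_add[OF plus(1) minus(1)] fourier_u split] by eventually_elim simp

  have W: "(W_norm n \<rho> \<Omega> u)\<^sup>2 = (\<integral>\<xi>. indicator ?C \<xi> *\<^sub>R ((cmod (?g \<xi>))\<^sup>2 * ?w \<xi>) \<partial>lborel) +
      (\<integral>\<xi>. indicator ?C' \<xi> *\<^sub>R ((cmod (?g \<xi>))\<^sup>2 * ?w' \<xi>) \<partial>lborel)"
  proof -
    have "0 \<le> ?sw \<xi>" for \<xi>
      using order_trans[OF zero_le_one weight_ge_1, of \<rho> n] by (simp add: sym_weight_def)
    then have "(W_norm n \<rho> \<Omega> u)\<^sup>2 = (\<integral>\<xi>. indicator ?S \<xi> *\<^sub>R ((cmod (?g \<xi>))\<^sup>2 * ?sw \<xi>) \<partial>lborel)"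
      unfolding W_norm_def by (rule L2_weighted_norm_sq)
    also have "\<dots> = (\<integral>\<xi>. indicator ?C \<xi> *\<^sub>R ((cmod (?g \<xi>))\<^sup>2 * ?w \<xi>) +
        indicator ?C' \<xi> *\<^sub>R ((cmod (?g \<xi>))\<^sup>2 * ?w' \<xi>) \<partial>lborel)"
    proof (rule integral_cong_AE)
      show "AE \<xi> in lborel. indicator ?S \<xi> *\<^sub>R ((cmod (?g \<xi>))\<^sup>2 * ?sw \<xi>) =
        indicator ?C \<xi> *\<^sub>R ((cmod (?g \<xi>))\<^sup>2 * ?w \<xi>) + indicator ?C' \<xi> *\<^sub>R ((cmod (?g \<xi>))\<^sup>2 * ?w' \<xi>)"
        using nz
      proof eventually_elim
        case (elim \<xi>)
        then have "indicator ?S \<xi> = (indicator ?C \<xi> + indicator ?C' \<xi> :: real)"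
          using disj[of \<xi>] by (auto simp: sym_cone_def indicator_def)
        then show ?case unfolding restrict[symmetric] restrict'[symmetric]
          using disj[of \<xi>] elim by (auto simp: sym_cone_def indicator_def)
      qed
    qed (use gw int int' in auto)
    also have "\<dots> = (\<integral>\<xi>. indicator ?C \<xi> *\<^sub>R ((cmod (?g \<xi>))\<^sup>2 * ?w \<xi>) \<partial>lborel) +
      (\<integral>\<xi>. indicator ?C' \<xi> *\<^sub>R ((cmod (?g \<xi>))\<^sup>2 * ?w' \<xi>) \<partial>lborel)"
      by (rule Bochner_Integration.integral_add[OF int int'])
    finally show ?thesis .
  qed

  obtain F where F: "F \<in> H_plus n \<rho> \<Omega>" "L2_tendsto (slice F) u\<^sub>p (at 0 within \<Omega>)"
    using plus(2) unfolding H_plus_def by blast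
  obtain G where G: "G \<in> H_minus n \<rho> \<Omega>" "L2_tendsto (\<lambda>y. slice G (- y)) u\<^sub>m (at 0 within \<Omega>)"
    using minus(2) unfolding H_minus_def L2_tendsto_reflect by blast
  have norms: "(W_norm n \<rho> \<Omega> u)\<^sup>2 = (H_plus_norm n \<rho> \<Omega> F)\<^sup>2 + (H_minus_norm n \<rho> \<Omega> G)\<^sup>2"
    unfolding W H_plus_norm_def H_minus_norm_def
    using plus(3)[OF F[unfolded H_plus_def]] minus(3)[OF G[unfolded H_minus_def L2_tendsto_reflect]] by simp
  show ?thesis
  proof (rule ex1I[of _ "(F, G)"])
    fix p :: "(complex ^ 'd \<Rightarrow> complex) \<times> (complex ^ 'd \<Rightarrow> complex)"
    obtain F' G' where p: "p = (F', G')" by (cases p)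
    assume "case p of (F\<^sub>p, F\<^sub>m) \<Rightarrow>
      F\<^sub>p \<in> H_plus n \<rho> \<Omega> \<and> F\<^sub>m \<in> H_minus n \<rho> \<Omega> \<and>
      L2_tendsto (slice F\<^sub>p) u\<^sub>p (at 0 within \<Omega>) \<and>
      L2_tendsto (\<lambda>y. slice F\<^sub>m (- y)) u\<^sub>m (at 0 within \<Omega>) \<and>
      (AE x in lborel. u x = u\<^sub>p x + u\<^sub>m x) \<and>
      (W_norm n \<rho> \<Omega> u)\<^sup>2 = (H_plus_norm n \<rho> \<Omega> F\<^sub>p)\<^sup>2 + (H_minus_norm n \<rho> \<Omega> F\<^sub>m)\<^sup>2"
    then have F': "F' \<in> H_plus n \<rho> \<Omega>" "L2_tendsto (slice F') u\<^sub>p (at 0 within \<Omega>)"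
      and G': "G' \<in> H_minus n \<rho> \<Omega>" "L2_tendsto (\<lambda>y. slice G' (- y)) u\<^sub>m (at 0 within \<Omega>)"
      unfolding p by simp_all
    have "F' = F" using plus(2) F F' unfolding H_plus_def by blast
    moreover have "G' = G" using minus(2) G G' unfolding H_minus_def L2_tendsto_reflect by blast
    ultimately show "p = (F, G)" by (simp add: p)
  qed (use F G sum norms in simp)
qed

end
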